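(* For any $\varepsilon\in(0,1]$, there exists a polynomial-space randomized algorithm for (weighted) $\mathrm{MAXCSP}$ running in $$O^\ast\left(\min_{\delta\ge 1+\frac{\varepsilon w}{\ell}}\left\{2^{\left(1-H\left(\frac{\varepsilon w}{(\delta-1)\ell}\right)\frac{\delta-1}{\delta}\right)n}\right\}\right)$$ time that finds with high probability an assignment $z\in\{0,1\}^n$ such that $\mathcal{W}(f,z)\ge w^\ast-\varepsilon w$.
   Context: Here $f$ is the input instance of (weighted) $\mathrm{MAXCSP}$ (the maximum constraint satisfaction problem), with $n$ Boolean variables $x_1,\dots,x_n$ and $m$ constraints $C_1,\dots,C_m$. Each constraint $C_i$ has a weight $w_i$, which is a positive real number, and $a_i$ denotes the number of variables in $C_i$. The total weight of $f$ is $w=\sum_{i=1}^m w_i$ and the weighted length of $f$ is $\ell=\sum_{i=1}^m a_iw_i$. For an assignment $z\in\{0,1\}^n$, $\mathcal{W}(f,z)$ is the sum of the weights of all constraints of $f$ satisfied by $z$, and $w^\ast=\max_{z\in\{0,1\}^n}\mathcal{W}(f,z)$. The binary entropy function is $H(p)=-p\log p-(1-p)\log(1-p)$ for $p\in[0,1]$, with logarithms in base $2$ and the convention $0\log 0=0$. The notation $O^\ast(\cdot)$ removes $\mathrm{poly}(n)$ factors.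
   Formalization: The factor suppressed by O* is a polynomial in n and the number m of constraints, not in n alone, since for fixed n and unbounded m the constraints cannot be read in poly(n) time; for m = poly(n) the two agree. *)

theory Defs
  imports "HOL-Probability.Probability" "HOL-Library.Log_Nat" "HOL-Real_Asymp.Real_Asymp"
begin

text \<open>A constraint is a positive real weight together with an arbitrary Boolean predicate on the
  tuple of values of the variables in its scope.  The predicate receives the values in the order in
  which the variables are listed.\<close>

datatype csp_constraint =
  CSP_Constraint (weight: real) (scope: "nat list") (pred: "bool list \<Rightarrow> bool")

datatype maxcsp = MAXCSP (nvars: nat) (constraints: "csp_constraint list")

abbreviation ncons :: "maxcsp \<Rightarrow> nat" where
  "ncons f \<equiv> length (constraints f)"

definition arity :: "csp_constraint \<Rightarrow> nat" where
  "arity C = length (scope C)"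

definition wf_maxcsp :: "maxcsp \<Rightarrow> bool" where
  "wf_maxcsp f \<longleftrightarrow> (\<forall>C\<in>set (constraints f).
     weight C > 0 \<and> distinct (scope C) \<and> set (scope C) \<subseteq> {..<nvars f})"

definition assignments :: "maxcsp \<Rightarrow> bool list set" where
  "assignments f = {z. length z = nvars f}"

definition satisfies :: "bool list \<Rightarrow> csp_constraint \<Rightarrow> bool" where
  "satisfies z C \<longleftrightarrow> pred C (map (\<lambda>j. z ! j) (scope C))"

definition sat_weight :: "maxcsp \<Rightarrow> bool list \<Rightarrow> real" where
  "sat_weight f z = (\<Sum>C\<leftarrow>constraints f. if satisfies z C then weight C else 0)"

definition opt_weight :: "maxcsp \<Rightarrow> real" where
  "opt_weight f = Max (sat_weight f ` assignments f)"

definition total_weight :: "maxcsp \<Rightarrow> real" where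
  "total_weight f = (\<Sum>C\<leftarrow>constraints f. weight C)"

definition weighted_length :: "maxcsp \<Rightarrow> real" where
  "weighted_length f = (\<Sum>C\<leftarrow>constraints f. real (arity C) * weight C)"

text \<open>The convention \<open>0 log 0 = 0\<close> holds automatically for the library logarithm.\<close>

definition binary_entropy :: "real \<Rightarrow> real" where
  "binary_entropy p = - p * log 2 p - (1 - p) * log 2 (1 - p)"

definition bound_at :: "real \<Rightarrow> maxcsp \<Rightarrow> real \<Rightarrow> real" where
  "bound_at \<epsilon> f \<delta> =
     2 powr ((1 - binary_entropy (\<epsilon> * total_weight f / ((\<delta> - 1) * weighted_length f))
                   * ((\<delta> - 1) / \<delta>)) * real (nvars f))"

text \<open>The minimum over \<open>\<delta>\<close>, written as an infimum; lemma \<open>min_bound_attained\<close> below shows that it is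
  attained whenever the formula makes sense, that is, when some constraint contains a variable.
  Otherwise \<open>weighted_length f = 0\<close>, and by \<open>x / 0 = 0\<close> the value is the trivial bound \<open>2 ^ nvars f\<close>.\<close>

definition min_bound :: "real \<Rightarrow> maxcsp \<Rightarrow> real" where
  "min_bound \<epsilon> f =
     (INF \<delta>\<in>{1 + \<epsilon> * total_weight f / weighted_length f..}. bound_at \<epsilon> f \<delta>)"

text \<open>The hidden factor is a polynomial in the size of the instance, measured by the number of
  variables and the number of constraints; it is a polynomial in \<open>nvars\<close> alone on every family of
  instances with polynomially many constraints.  (Merely reading the constraints takes time
  at least \<open>ncons\<close>.)\<close>

definition O_star :: "(maxcsp \<Rightarrow> real) \<Rightarrow> (maxcsp \<Rightarrow> real) set" where
  "O_star g = {h. \<exists>K d. \<forall>f. wf_maxcsp f \<longrightarrow>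
     h f \<le> K * real (nvars f + ncons f + 1) ^ d * g f}"

text \<open>The computation model is a structured random access machine with fair coin flips.  It has a
  memory of natural numbers and a memory of real numbers, both initially zero.  The instance is
  read-only: a program can ask for the number of variables and of constraints, for the scopes and
  the weights, and can test whether constraint \<open>i\<close> is satisfied by the assignment stored in the
  cells \<open>b, \<dots>, b + nvars f - 1\<close> (nonzero meaning true); predicates can be accessed in no other
  way, so that nothing depends on how they are represented, as long as they can be evaluated
  in polynomial time.  Real numbers are only obtained from the weights, from the fixed accuracy
  parameter \<open>\<epsilon>\<close> and from natural numbers, and can only be inspected by comparisons.\<close>

datatype aexp =
    Const nat
  | Load aexp
  | Add aexp aexp
  | Sub aexp aexp
  | Mul aexp aexp
  | Div aexp aexp
  | NVars
  | NCons
  | Arity aexp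
  | ScopeVar aexp aexp

datatype rexp =
    RLoad aexp
  | RWeight aexp
  | REps
  | RNat aexp
  | RAdd rexp rexp
  | RSub rexp rexp
  | RMul rexp rexp

datatype bexp =
    Leq aexp aexp
  | RLeq rexp rexp
  | SatTest aexp aexp
  | BNot bexp
  | BAnd bexp bexp

datatype com =
    Skip
  | Store aexp aexp
  | RStore aexp rexp
  | Flip aexp
  | Seq com com
  | Cond bexp com com
  | While bexp com

text \<open>Every real cell carries, besides its value, the formal length of the value: input reals have
  length one, natural numbers their bit length plus one, and arithmetic operations add the lengths.
  Up to a constant factor this is the number of bits needed per bit of the input reals, in case these
  are rational.  It prevents a program from hiding a large amount of data in a single real cell.\<close>

record state =
  mem :: "nat \<Rightarrow> nat"
  rmem :: "nat \<Rightarrow> real \<times> nat"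

definition init_state :: state where
  "init_state = \<lparr>mem = (\<lambda>_. 0), rmem = (\<lambda>_. (0, 0))\<rparr>"

fun aval :: "maxcsp \<Rightarrow> state \<Rightarrow> aexp \<Rightarrow> nat" where
  "aval f s (Const k) = k"
| "aval f s (Load a) = mem s (aval f s a)"
| "aval f s (Add a b) = aval f s a + aval f s b"
| "aval f s (Sub a b) = aval f s a - aval f s b"
| "aval f s (Mul a b) = aval f s a * aval f s b"
| "aval f s (Div a b) = aval f s a div aval f s b"
| "aval f s NVars = nvars f"
| "aval f s NCons = ncons f"
| "aval f s (Arity a) =
     (let i = aval f s a in if i < ncons f then arity (constraints f ! i) else 0)"
| "aval f s (ScopeVar a b) =
     (let i = aval f s a; p = aval f s b in
      if i < ncons f \<and> p < arity (constraints f ! i) then scope (constraints f ! i) ! p else 0)"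

fun rval :: "real \<Rightarrow> maxcsp \<Rightarrow> state \<Rightarrow> rexp \<Rightarrow> real" where
  "rval \<epsilon> f s (RLoad a) = fst (rmem s (aval f s a))"
| "rval \<epsilon> f s (RWeight a) =
     (let i = aval f s a in if i < ncons f then weight (constraints f ! i) else 0)"
| "rval \<epsilon> f s REps = \<epsilon>"
| "rval \<epsilon> f s (RNat a) = real (aval f s a)"
| "rval \<epsilon> f s (RAdd x y) = rval \<epsilon> f s x + rval \<epsilon> f s y"
| "rval \<epsilon> f s (RSub x y) = rval \<epsilon> f s x - rval \<epsilon> f s y"
| "rval \<epsilon> f s (RMul x y) = rval \<epsilon> f s x * rval \<epsilon> f s y"

fun rlen :: "maxcsp \<Rightarrow> state \<Rightarrow> rexp \<Rightarrow> nat" where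
  "rlen f s (RLoad a) = snd (rmem s (aval f s a))"
| "rlen f s (RWeight a) = 1"
| "rlen f s REps = 1"
| "rlen f s (RNat a) = floorlog 2 (aval f s a) + 1"
| "rlen f s (RAdd x y) = rlen f s x + rlen f s y + 1"
| "rlen f s (RSub x y) = rlen f s x + rlen f s y + 1"
| "rlen f s (RMul x y) = rlen f s x + rlen f s y + 1"

definition stored_assignment :: "maxcsp \<Rightarrow> state \<Rightarrow> nat \<Rightarrow> bool list" where
  "stored_assignment f s b = map (\<lambda>j. mem s (b + j) \<noteq> 0) [0..<nvars f]"

fun bval :: "real \<Rightarrow> maxcsp \<Rightarrow> state \<Rightarrow> bexp \<Rightarrow> bool" where
  "bval \<epsilon> f s (Leq a b) \<longleftrightarrow> aval f s a \<le> aval f s b"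
| "bval \<epsilon> f s (RLeq x y) \<longleftrightarrow> rval \<epsilon> f s x \<le> rval \<epsilon> f s y"
| "bval \<epsilon> f s (SatTest a b) \<longleftrightarrow>
     (let i = aval f s a in
      i < ncons f \<and> satisfies (stored_assignment f s (aval f s b)) (constraints f ! i))"
| "bval \<epsilon> f s (BNot x) \<longleftrightarrow> \<not> bval \<epsilon> f s x"
| "bval \<epsilon> f s (BAnd x y) \<longleftrightarrow> bval \<epsilon> f s x \<and> bval \<epsilon> f s y"

type_synonym config = "com \<times> state"

fun step :: "real \<Rightarrow> maxcsp \<Rightarrow> config \<Rightarrow> config pmf" where
  "step \<epsilon> f (Skip, s) = return_pmf (Skip, s)"
| "step \<epsilon> f (Store a b, s) =
     return_pmf (Skip, s\<lparr>mem := (mem s)(aval f s a := aval f s b)\<rparr>)"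
| "step \<epsilon> f (RStore a x, s) =
     return_pmf (Skip, s\<lparr>rmem := (rmem s)(aval f s a := (rval \<epsilon> f s x, rlen f s x))\<rparr>)"
| "step \<epsilon> f (Flip a, s) =
     map_pmf (\<lambda>b. (Skip, s\<lparr>mem := (mem s)(aval f s a := of_bool b)\<rparr>)) (bernoulli_pmf (1/2))"
| "step \<epsilon> f (Seq c d, s) =
     (if c = Skip then return_pmf (d, s)
      else map_pmf (\<lambda>(c', s'). (Seq c' d, s')) (step \<epsilon> f (c, s)))"
| "step \<epsilon> f (Cond b c d, s) = return_pmf (if bval \<epsilon> f s b then c else d, s)"
| "step \<epsilon> f (While b c, s) = return_pmf (Cond b (Seq c (While b c)) Skip, s)"

fun run :: "real \<Rightarrow> maxcsp \<Rightarrow> com \<Rightarrow> nat \<Rightarrow> config pmf" where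
  "run \<epsilon> f P 0 = return_pmf (P, init_state)"
| "run \<epsilon> f P (Suc t) = bind_pmf (run \<epsilon> f P t) (step \<epsilon> f)"

text \<open>Both bounds are worst-case with respect to the coin flips.  Time is the number of steps, space
  the number of bits needed to list all used cells with their addresses.  A step evaluates
  expressions of constant size only, so it costs time polynomial in the space and in the size of the
  instance; for programs using polynomial space, unit-cost and bit-cost time thus agree up to
  polynomial factors.  Only finitely many cells are used at any time
  (lemma \<open>finite_used_cells\<close> below), so the sums are not degenerate.\<close>

definition halts_within :: "real \<Rightarrow> maxcsp \<Rightarrow> com \<Rightarrow> nat \<Rightarrow> bool" where
  "halts_within \<epsilon> f P t \<longleftrightarrow> (\<forall>(c, s)\<in>set_pmf (run \<epsilon> f P t). c = Skip)"

definition space :: "state \<Rightarrow> nat" where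
  "space s = (\<Sum>a | mem s a \<noteq> 0. floorlog 2 a + floorlog 2 (mem s a))
           + (\<Sum>a | snd (rmem s a) \<noteq> 0. floorlog 2 a + snd (rmem s a))"

definition space_within :: "real \<Rightarrow> maxcsp \<Rightarrow> com \<Rightarrow> nat \<Rightarrow> bool" where
  "space_within \<epsilon> f P k \<longleftrightarrow> (\<forall>t. \<forall>(c, s)\<in>set_pmf (run \<epsilon> f P t). space s \<le> k)"

definition output_assignment :: "maxcsp \<Rightarrow> state \<Rightarrow> bool list" where
  "output_assignment f s = stored_assignment f s 0"

lemma finite_used_cells_step:
  assumes "cs' \<in> set_pmf (step \<epsilon> f cs)"
    and "finite {a. mem (snd cs) a \<noteq> 0} \<and> finite {a. rmem (snd cs) a \<noteq> (0, 0)}"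
  shows "finite {a. mem (snd cs') a \<noteq> 0} \<and> finite {a. rmem (snd cs') a \<noteq> (0, 0)}"
proof -
  have upd: "finite {a. (g(i := v)) a \<noteq> z}" if "finite {a. g a \<noteq> z}"
    for g :: "nat \<Rightarrow> 'b" and i v z
    by (rule finite_subset[of _ "insert i {a. g a \<noteq> z}"]) (use that in auto)
  show ?thesis
    using assms
  proof (induction \<epsilon> f cs arbitrary: cs' rule: step.induct)
    case (2 \<epsilon> f a b s)
    then show ?case using upd[of "mem s" 0] by (simp del: fun_upd_apply)
  next
    case (3 \<epsilon> f a x s)
    then show ?case using upd[of "rmem s" "(0, 0)"] by (simp del: fun_upd_apply)
  next
    case (4 \<epsilon> f a s)
    then show ?case using upd[of "mem s" 0] by (auto simp del: fun_upd_apply)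
  next
    case (5 \<epsilon> f c d s)
    show ?case
    proof (cases "c = Skip")
      case True
      with 5 show ?thesis by simp
    next
      case False
      with 5(2) obtain c' s' where "(c', s') \<in> set_pmf (step \<epsilon> f (c, s))" "cs' = (Seq c' d, s')"
        by auto
      with 5(1)[OF False this(1)] 5(3) show ?thesis by simp
    qed
  qed auto
qed

lemma finite_used_cells:
  assumes "(c, s) \<in> set_pmf (run \<epsilon> f P t)"
  shows "finite {a. mem s a \<noteq> 0}" "finite {a. rmem s a \<noteq> (0, 0)}" "finite {a. snd (rmem s a) \<noteq> 0}"
proof -
  have "finite {a. mem (snd cs) a \<noteq> 0} \<and> finite {a. rmem (snd cs) a \<noteq> (0, 0)}"
    if "cs \<in> set_pmf (run \<epsilon> f P t)" for cs
    using that
  proof (induction t arbitrary: cs)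
    case 0
    then show ?case by (simp add: init_state_def)
  next
    case (Suc t)
    then obtain cs0 where "cs0 \<in> set_pmf (run \<epsilon> f P t)" "cs \<in> set_pmf (step \<epsilon> f cs0)"
      by auto
    with Suc.IH finite_used_cells_step show ?case by blast
  qed
  from this[OF assms] show m: "finite {a. mem s a \<noteq> 0}" and r: "finite {a. rmem s a \<noteq> (0, 0)}"
    by simp_all
  show "finite {a. snd (rmem s a) \<noteq> 0}"
    by (rule finite_subset[OF _ r]) auto
qed

lemma binary_entropy_nonneg:
  assumes "0 \<le> p" "p \<le> 1"
  shows "binary_entropy p \<ge> 0"
proof -
  have "x * log 2 x \<le> 0" if "0 \<le> x" "x \<le> 1" for x :: real
    using that by (cases "x = 0") (auto intro!: mult_nonneg_nonpos)
  from this[of p] this[of "1 - p"] assms show ?thesis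
    by (simp add: binary_entropy_def)
qed

lemma continuous_on_xlogx: "continuous_on {0..} (\<lambda>x::real. x * log 2 x)"
proof -
  have "((\<lambda>x::real. x * log 2 x) \<longlongrightarrow> 0) (at_right 0)"
    by real_asymp
  moreover have "at 0 within {0::real..} = at_right 0"
    by (simp add: at_within_Ici_at_right)
  ultimately have "((\<lambda>x::real. x * log 2 x) \<longlongrightarrow> 0 * log 2 0) (at 0 within {0..})"
    by simp
  moreover have "((\<lambda>x::real. x * log 2 x) \<longlongrightarrow> y * log 2 y) (at y within {0..})" if "y > 0" for y
    using that by (intro tendsto_intros) auto
  ultimately show ?thesis
    unfolding continuous_on_def by (metis atLeast_iff order_le_less)
qed

lemma continuous_on_binary_entropy: "continuous_on {0..1} binary_entropy"
proof -
  have 1: "continuous_on {0..1} (\<lambda>x::real. x * log 2 x)"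
    by (rule continuous_on_subset[OF continuous_on_xlogx]) auto
  have 2: "continuous_on {0..1} (\<lambda>x::real. (1 - x) * log 2 (1 - x))"
    by (rule continuous_on_compose2[OF continuous_on_xlogx, where f = "\<lambda>x. 1 - x"])
       (auto intro!: continuous_intros)
  have "binary_entropy = (\<lambda>p. - (p * log 2 p) - (1 - p) * log 2 (1 - p))"
    by (auto simp: binary_entropy_def)
  then show ?thesis
    by (rule ssubst) (rule continuous_on_diff[OF continuous_on_minus[OF 1] 2])
qed

lemma min_bound_attained:
  assumes wf: "wf_maxcsp f" and \<epsilon>: "0 < \<epsilon>" and l: "weighted_length f > 0"
  obtains \<delta> where "\<delta> \<ge> 1 + \<epsilon> * total_weight f / weighted_length f"
    and "min_bound \<epsilon> f = bound_at \<epsilon> f \<delta>"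
    and "\<And>\<delta>'. \<delta>' \<ge> 1 + \<epsilon> * total_weight f / weighted_length f \<Longrightarrow> bound_at \<epsilon> f \<delta> \<le> bound_at \<epsilon> f \<delta>'"
proof -
  define a where "a = \<epsilon> * total_weight f / weighted_length f"
  obtain C Cs where C: "constraints f = C # Cs"
    using l by (cases "constraints f") (auto simp: weighted_length_def)
  have "(\<Sum>C\<leftarrow>Cs. weight C) \<ge> 0"
    using wf C by (intro sum_list_nonneg) (auto simp: wf_maxcsp_def less_imp_le)
  then have "total_weight f > 0"
    using wf C by (auto simp: total_weight_def wf_maxcsp_def)
  then have a: "a > 0"
    using \<epsilon> l by (simp add: a_def)
  define g where "g \<delta> = binary_entropy (a / (\<delta> - 1)) * ((\<delta> - 1) / \<delta>)" for \<delta> :: real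
  have bound_eq: "bound_at \<epsilon> f \<delta> = 2 powr ((1 - g \<delta>) * real (nvars f))" for \<delta>
    by (simp add: bound_at_def g_def a_def mult.commute)
  have arg: "a / (\<delta> - 1) \<in> {0..1}" if "\<delta> \<ge> 1 + a" for \<delta>
    using that a by (auto simp: field_simps)
  have g_nonneg: "g \<delta> \<ge> 0" if "\<delta> \<ge> 1 + a" for \<delta>
    unfolding g_def using that a arg[OF that]
    by (intro mult_nonneg_nonneg binary_entropy_nonneg) auto
  have g_cont: "continuous_on {1 + a..} g"
    unfolding g_def using a arg
    by (intro continuous_on_mult continuous_on_compose2[OF continuous_on_binary_entropy]
        continuous_intros) auto
  have g_lim: "(g \<longlongrightarrow> 0) at_top"
    unfolding g_def binary_entropy_def using a by real_asymp
  have "\<exists>\<delta>\<ge>1 + a. \<forall>\<delta>'\<ge>1 + a. g \<delta>' \<le> g \<delta>"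
  proof (cases "\<forall>\<delta>\<ge>1 + a. g \<delta> = 0")
    case True
    then show ?thesis by (intro exI[of _ "1 + a"]) auto
  next
    case False
    then obtain \<delta>1 where \<delta>1: "\<delta>1 \<ge> 1 + a" "g \<delta>1 > 0"
      using g_nonneg by (metis order_le_less)
    then have "eventually (\<lambda>\<delta>. g \<delta> < g \<delta>1) at_top"
      using g_lim by (simp add: order_tendstoD(2))
    then obtain B where B: "\<And>\<delta>. \<delta> \<ge> B \<Longrightarrow> g \<delta> < g \<delta>1"
      by (auto simp: eventually_at_top_linorder)
    define B' where "B' = max B \<delta>1"
    have "\<exists>\<delta>\<in>{1 + a..B'}. \<forall>\<delta>'\<in>{1 + a..B'}. g \<delta>' \<le> g \<delta>"
      using \<delta>1 by (intro continuous_attains_sup continuous_on_subset[OF g_cont]) (auto simp: B'_def)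
    then obtain \<delta> where \<delta>: "\<delta> \<in> {1 + a..B'}" "\<And>\<delta>'. \<delta>' \<in> {1 + a..B'} \<Longrightarrow> g \<delta>' \<le> g \<delta>"
      by auto
    have "g \<delta>' \<le> g \<delta>" if "\<delta>' \<ge> 1 + a" for \<delta>'
    proof (cases "\<delta>' \<le> B'")
      case True
      then show ?thesis using \<delta>(2) that by auto
    next
      case False
      then have "g \<delta>' < g \<delta>1" using B by (auto simp: B'_def)
      also have "g \<delta>1 \<le> g \<delta>" using \<delta>(2)[of \<delta>1] \<delta>1 by (auto simp: B'_def)
      finally show ?thesis by simp
    qed
    with \<delta>(1) show ?thesis by auto
  qed
  then obtain \<delta> where \<delta>: "\<delta> \<ge> 1 + a" "\<And>\<delta>'. \<delta>' \<ge> 1 + a \<Longrightarrow> g \<delta>' \<le> g \<delta>"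
    by auto
  then have le: "bound_at \<epsilon> f \<delta> \<le> bound_at \<epsilon> f \<delta>'" if "\<delta>' \<ge> 1 + a" for \<delta>'
    using that by (auto simp: bound_eq intro!: mult_right_mono)
  have "min_bound \<epsilon> f = bound_at \<epsilon> f \<delta>"
    unfolding min_bound_def a_def[symmetric] using \<delta>(1) le
    by (intro cInf_eq_minimum) auto
  with that \<delta>(1) le show ?thesis
    by (simp add: a_def)
qed

end

theory Submission
  imports Defs
begin

text \<open>The algorithm draws assignments uniformly at random and keeps the best one; only the number of
  samples has to be computed.  Let \<open>D j\<close> be the weighted degree of variable \<open>j\<close>, so that
  \<open>\<Sum>j. D j\<close> is the weighted length \<open>l\<close>.  Flipping \<open>r\<close> variables of an optimal assignment, each with
  \<open>r * D j \<le> \<epsilon> * w\<close>, loses at most \<open>\<epsilon> * w\<close>.  If \<open>N r\<close> variables satisfy this inequality, then at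
  least \<open>M = (MAX r. N r choose r)\<close> assignments are good enough, and \<open>k * n * (2 ^ n div M + 1)\<close>
  samples fail with probability at most \<open>exp (- k * n)\<close>.  The number \<open>M\<close> is computable in
  polynomial time.

  To compare \<open>2 ^ n / M\<close> with the bound for \<open>\<delta>\<close>, let \<open>p = \<epsilon> * w / ((\<delta> - 1) * l)\<close>,
  \<open>x = (\<delta> - 1) / \<delta> * n\<close> and \<open>r = \<lfloor>p * x\<rfloor>\<close>.  A variable that violates \<open>r * D j \<le> \<epsilon> * w\<close> has degree
  more than \<open>\<delta> * l / n\<close>; there are at most \<open>n / \<delta>\<close> of these, so \<open>N r \<ge> x\<close>, and
  \<open>N r choose r\<close> is at least \<open>2 powr (H p * x)\<close> up to a factor \<open>(n + 1) ^ 2\<close>.\<close>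

section \<open>A program logic for running time, space and success probability\<close>

text \<open>\<open>run\<close> appends a step at the end and starts only in
  \<open>init_state\<close>. Peeling off the first step from an arbitrary configuration suits
  reasoning along the program text; \<open>run_eq_steps\<close> connects the two.\<close>

fun steps :: "real \<Rightarrow> maxcsp \<Rightarrow> nat \<Rightarrow> config \<Rightarrow> config pmf" where
  "steps \<epsilon> f 0 x = return_pmf x"
| "steps \<epsilon> f (Suc t) x = bind_pmf (step \<epsilon> f x) (steps \<epsilon> f t)"

lemma steps_Suc_right: "steps \<epsilon> f (Suc t) x = bind_pmf (steps \<epsilon> f t x) (step \<epsilon> f)"
proof (induction t arbitrary: x)
  case 0
  have "steps \<epsilon> f 0 = return_pmf" by auto
  then show ?case by (simp add: bind_return_pmf bind_return_pmf')
next
  case (Suc t)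
  have "steps \<epsilon> f (Suc t) = (\<lambda>y. bind_pmf (steps \<epsilon> f t y) (step \<epsilon> f))"
    using Suc by (rule ext)
  then have "steps \<epsilon> f (Suc (Suc t)) x = bind_pmf (bind_pmf (step \<epsilon> f x) (steps \<epsilon> f t)) (step \<epsilon> f)"
    by (simp only: steps.simps(2)[of _ _ "Suc t"] bind_assoc_pmf)
  then show ?case by (simp only: steps.simps(2))
qed

lemma run_eq_steps: "run \<epsilon> f c t = steps \<epsilon> f t (c, init_state)"
proof (induction t)
  case (Suc t)
  then show ?case by (simp only: run.simps steps_Suc_right)
qed simp

lemma steps_Skip [simp]: "steps \<epsilon> f t (Skip, s) = return_pmf (Skip, s)"
  by (induction t) (auto simp: bind_return_pmf)

section \<open>Halting computations, their output distributions and a state invariant\<close>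

context
  fixes \<epsilon> :: real and f :: maxcsp and I :: "state \<Rightarrow> bool"
begin

text \<open>Equality with the image under \<open>Pair Skip\<close> says at once that every coin
  sequence has halted by time \<open>t\<close> and that \<open>\<mu>\<close> is the law of the final
  state. The invariant is asked for at every time \<open>t'\<close>, because
  \<open>space_within\<close> ranges over all times.\<close>

definition yields :: "com \<Rightarrow> state \<Rightarrow> nat \<Rightarrow> state pmf \<Rightarrow> bool" where
  "yields c s t \<mu> \<longleftrightarrow> steps \<epsilon> f t (c, s) = map_pmf (Pair Skip) \<mu> \<and>
     (\<forall>t'. \<forall>x\<in>set_pmf (steps \<epsilon> f t' (c, s)). I (snd x))"

lemma yields_inv_start: "yields c s t \<mu> \<Longrightarrow> I s"
  unfolding yields_def by (metis steps.simps(1) set_return_pmf singletonI snd_conv)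

lemma yields_inv_end: "yields c s t \<mu> \<Longrightarrow> s' \<in> set_pmf \<mu> \<Longrightarrow> I s'"
  unfolding yields_def
  by (metis (no_types, lifting) imageI set_map_pmf snd_conv)

lemma yields_Skip: "I s \<Longrightarrow> yields Skip s t (return_pmf s)"
  by (simp add: yields_def)

lemma yields_Skip_eq: "yields Skip s t \<mu> \<Longrightarrow> \<mu> = return_pmf s"
  unfolding yields_def
  by (metis (no_types, lifting) map_return_pmf pmf.inj_map_strong prod.inject steps_Skip)

text \<open>Configurations with command \<open>Skip\<close> are fixed points of \<open>step\<close>,
  so a larger budget changes nothing.\<close>

lemma steps_halted:
  assumes "steps \<epsilon> f t x = map_pmf (Pair Skip) \<mu>"
  shows "steps \<epsilon> f (t + u) x = map_pmf (Pair Skip) \<mu>"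
proof (induction u)
  case (Suc u)
  have "steps \<epsilon> f (t + Suc u) x = bind_pmf (map_pmf (Pair Skip) \<mu>) (step \<epsilon> f)"
    using Suc by (simp only: add_Suc_right steps_Suc_right)
  also have "\<dots> = bind_pmf \<mu> (\<lambda>s. return_pmf (Skip, s))"
    by (simp add: bind_map_pmf)
  finally show ?case by (simp add: map_pmf_def)
qed (use assms in simp)

lemma yields_mono: "yields c s t \<mu> \<Longrightarrow> t \<le> t' \<Longrightarrow> yields c s t' \<mu>"
  unfolding yields_def using steps_halted by (metis le_add_diff_inverse)

lemma yields_step:
  assumes "step \<epsilon> f (c, s) = return_pmf (c', s)" "yields c' s t \<mu>"
  shows "yields c s (Suc t) \<mu>"
  unfolding yields_def
proof (intro conjI allI)
  show "steps \<epsilon> f (Suc t) (c, s) = map_pmf (Pair Skip) \<mu>"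
    using assms by (simp add: yields_def bind_return_pmf)
  fix t' show "\<forall>x\<in>set_pmf (steps \<epsilon> f t' (c, s)). I (snd x)"
    using assms yields_inv_start[OF assms(2)]
    by (cases t') (auto simp: yields_def bind_return_pmf)
qed

text \<open>Everything a successor configuration can reach in \<open>t\<close> steps is reachable
  from the start in \<open>t + 1\<close>. So each successor has halted as well, and
  \<open>map_pmf snd\<close> discards only the command \<open>Skip\<close>.\<close>

lemma yields_first_step:
  assumes "yields c s (Suc t) \<mu>"
  defines "\<nu> \<equiv> \<lambda>x. map_pmf snd (steps \<epsilon> f t x)"
  shows "\<mu> = bind_pmf (step \<epsilon> f (c, s)) \<nu>"
    and "(c', s') \<in> set_pmf (step \<epsilon> f (c, s)) \<Longrightarrow> yields c' s' t (\<nu> (c', s'))"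
proof -
  have st: "bind_pmf (step \<epsilon> f (c, s)) (steps \<epsilon> f t) = map_pmf (Pair Skip) \<mu>"
    using assms(1) by (simp add: yields_def)
  have "\<mu> = map_pmf snd (map_pmf (Pair Skip) \<mu>)"
    by (simp add: map_pmf_comp)
  also have "\<dots> = bind_pmf (step \<epsilon> f (c, s)) \<nu>"
    unfolding st[symmetric] \<nu>_def by (simp add: map_bind_pmf)
  finally show "\<mu> = bind_pmf (step \<epsilon> f (c, s)) \<nu>" .
  assume mem: "(c', s') \<in> set_pmf (step \<epsilon> f (c, s))"
  have "x = (Skip, snd x)" if "x \<in> set_pmf (steps \<epsilon> f t (c', s'))" for x
  proof -
    have "x \<in> set_pmf (map_pmf (Pair Skip) \<mu>)"
      unfolding st[symmetric] using that mem by auto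
    then show ?thesis by auto
  qed
  then have "map_pmf (\<lambda>x. (Skip, snd x)) (steps \<epsilon> f t (c', s')) = map_pmf id (steps \<epsilon> f t (c', s'))"
    by (intro map_pmf_cong) auto
  then have "steps \<epsilon> f t (c', s') = map_pmf (Pair Skip) (\<nu> (c', s'))"
    by (simp add: \<nu>_def map_pmf_comp)
  moreover have "I (snd x)" if "x \<in> set_pmf (steps \<epsilon> f t' (c', s'))" for t' x
  proof -
    have "x \<in> set_pmf (steps \<epsilon> f (Suc t') (c, s))"
      using that mem by auto
    then show ?thesis using assms(1) unfolding yields_def by blast
  qed
  ultimately show "yields c' s' t (\<nu> (c', s'))"
    by (simp add: yields_def)
qed

text \<open>Induction on the budget of \<open>c\<close>, following its first step. The extra unit
  pays for the transition from \<open>Seq Skip d\<close> to \<open>d\<close>.\<close>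

lemma yields_Seq:
  assumes "yields c s t \<mu>" "\<And>s'. s' \<in> set_pmf \<mu> \<Longrightarrow> yields d s' u (\<nu> s')"
  shows "yields (Seq c d) s (t + u + 1) (bind_pmf \<mu> \<nu>)"
  using assms
proof (induction t arbitrary: c s \<mu>)
  case t: (Suc t)
  show ?case
  proof (cases "c = Skip")
    case True
    with t have "\<mu> = return_pmf s" using yields_Skip_eq by blast
    with t have "yields d s (Suc t + u) (\<nu> s)" by (auto intro: yields_mono)
    then have "yields (Seq c d) s (Suc (Suc t + u)) (\<nu> s)"
      by (rule yields_step[rotated]) (simp add: True)
    then show ?thesis by (simp add: \<open>\<mu> = return_pmf s\<close> bind_return_pmf)
  next
    case False
    define \<rho> where "\<rho> x = map_pmf snd (steps \<epsilon> f t x)" for x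
    note fs = yields_first_step[OF t.prems(1), folded \<rho>_def]
    have IH: "yields (Seq c' d) s' (t + u + 1) (bind_pmf (\<rho> (c', s')) \<nu>)"
      if "(c', s') \<in> set_pmf (step \<epsilon> f (c, s))" for c' s'
      by (rule t.IH[OF fs(2)[OF that]]) (use fs(1) that t.prems(2) in auto)
    have step: "step \<epsilon> f (Seq c d, s) = map_pmf (\<lambda>(c', s'). (Seq c' d, s')) (step \<epsilon> f (c, s))"
      using False by simp
    show ?thesis
      unfolding yields_def
    proof (intro conjI allI ballI)
      have "steps \<epsilon> f (Suc t + u + 1) (Seq c d, s) =
          bind_pmf (step \<epsilon> f (c, s)) (\<lambda>(c', s'). steps \<epsilon> f (t + u + 1) (Seq c' d, s'))"
        by (simp add: step bind_map_pmf case_prod_unfold del: step.simps)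
      also have "\<dots> = bind_pmf (step \<epsilon> f (c, s)) (\<lambda>x. map_pmf (Pair Skip) (bind_pmf (\<rho> x) \<nu>))"
        by (intro bind_pmf_cong) (use IH in \<open>auto simp: yields_def\<close>)
      finally show "steps \<epsilon> f (Suc t + u + 1) (Seq c d, s) = map_pmf (Pair Skip) (bind_pmf \<mu> \<nu>)"
        by (simp add: fs(1) bind_assoc_pmf map_bind_pmf)
      fix t' x assume x: "x \<in> set_pmf (steps \<epsilon> f t' (Seq c d, s))"
      show "I (snd x)"
      proof (cases t')
        case 0
        then show ?thesis using x yields_inv_start[OF t.prems(1)] by simp
      next
        case (Suc t'')
        then obtain c' s' where "(c', s') \<in> set_pmf (step \<epsilon> f (c, s))"
          "x \<in> set_pmf (steps \<epsilon> f t'' (Seq c' d, s'))"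
          using x by (auto simp: step simp del: step.simps)
        then show ?thesis using IH unfolding yields_def by blast
      qed
    qed
  qed
next
  case 0
  \<comment> \<open>A point mass at \<open>(c, s)\<close> that is an image under
    \<open>Pair Skip\<close> forces \<open>c = Skip\<close>.\<close>
  then have "map_pmf (Pair Skip) \<mu> = return_pmf (c, s)" by (simp add: yields_def)
  then have "set_pmf (map_pmf (Pair Skip) \<mu>) = {(c, s)}" by simp
  then have "c = Skip" by auto
  with 0 have "\<mu> = return_pmf s" using yields_Skip_eq by blast
  with 0 have "yields d s u (\<nu> s)" by auto
  then have "yields (Seq c d) s (Suc u) (\<nu> s)"
    by (rule yields_step[rotated]) (simp add: \<open>c = Skip\<close>)
  then show ?case by (simp add: \<open>\<mu> = return_pmf s\<close> bind_return_pmf)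
qed

text \<open>From state \<open>s\<close>, program \<open>c\<close> halts within \<open>t\<close> steps, visits only states satisfying \<open>I\<close>, ends in a
  state satisfying \<open>Q\<close>, and the expectation of \<open>\<psi>\<close> in the final state is at least \<open>v\<close>.\<close>

definition ev :: "com \<Rightarrow> state \<Rightarrow> nat \<Rightarrow> (state \<Rightarrow> bool) \<Rightarrow> (state \<Rightarrow> real) \<Rightarrow> real \<Rightarrow> bool" where
  "ev c s t Q \<psi> v \<longleftrightarrow> (\<exists>\<mu>. yields c s t \<mu> \<and> (\<forall>s'\<in>set_pmf \<mu>. Q s') \<and>
     ennreal v \<le> (\<integral>\<^sup>+ s'. ennreal (\<psi> s') \<partial>measure_pmf \<mu>))"

section \<open>Rules for lower bounds on expectations\<close>

lemma ev_mono:
  assumes "ev c s t Q \<psi> v" "\<And>s'. I s' \<Longrightarrow> Q s' \<Longrightarrow> Q' s'" "\<And>s'. I s' \<Longrightarrow> Q s' \<Longrightarrow> \<psi> s' \<le> \<psi>' s'"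
    "v' \<le> v" "t \<le> t'"
  shows "ev c s t' Q' \<psi>' v'"
proof -
  obtain \<mu> where \<mu>: "yields c s t \<mu>" "\<forall>s'\<in>set_pmf \<mu>. Q s'"
    "ennreal v \<le> (\<integral>\<^sup>+ s'. ennreal (\<psi> s') \<partial>measure_pmf \<mu>)"
    using assms(1) unfolding ev_def by blast
  have "(\<integral>\<^sup>+ s'. ennreal (\<psi> s') \<partial>measure_pmf \<mu>) \<le> (\<integral>\<^sup>+ s'. ennreal (\<psi>' s') \<partial>measure_pmf \<mu>)"
    using \<mu> assms(3) yields_inv_end[OF \<mu>(1)]
    by (intro nn_integral_mono_AE) (auto simp: AE_measure_pmf_iff intro!: ennreal_leI)
  then have "ennreal v' \<le> (\<integral>\<^sup>+ s'. ennreal (\<psi>' s') \<partial>measure_pmf \<mu>)"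
    using \<mu>(3) assms(4) by (meson ennreal_leI order_trans)
  then show ?thesis
    unfolding ev_def using \<mu> assms(2,5) yields_mono yields_inv_end[OF \<mu>(1)] by blast
qed

lemma ev_Skip: "I s \<Longrightarrow> Q s \<Longrightarrow> v \<le> \<psi> s \<Longrightarrow> ev Skip s t Q \<psi> v"
  unfolding ev_def by (intro exI[of _ "return_pmf s"]) (auto intro: yields_Skip ennreal_leI)

lemma yields_once:
  assumes "step \<epsilon> f (c, s) = map_pmf (Pair Skip) \<mu>" "I s" "\<And>s'. s' \<in> set_pmf \<mu> \<Longrightarrow> I s'"
  shows "yields c s (Suc t) \<mu>"
proof -
  have eq: "steps \<epsilon> f (Suc u) (c, s) = map_pmf (Pair Skip) \<mu>" for u
    by (simp add: assms(1) bind_map_pmf) (simp add: map_pmf_def)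
  have "I (snd x)" if "x \<in> set_pmf (steps \<epsilon> f t' (c, s))" for t' x
  proof (cases t')
    case 0
    then show ?thesis using that assms(2) by simp
  next
    case (Suc u)
    then show ?thesis using that assms(3) unfolding Suc eq by auto
  qed
  then show ?thesis using eq by (simp only: yields_def) blast
qed

lemma ev_Store:
  assumes "I s" "s' = s\<lparr>mem := (mem s)(aval f s a := aval f s b)\<rparr>" "I s'" "Q s'" "v \<le> \<psi> s'"
  shows "ev (Store a b) s (Suc t) Q \<psi> v"
  unfolding ev_def using assms
  by (intro exI[of _ "return_pmf s'"]) (auto intro!: yields_once ennreal_leI)

lemma ev_RStore:
  assumes "I s" "s' = s\<lparr>rmem := (rmem s)(aval f s a := (rval \<epsilon> f s x, rlen f s x))\<rparr>"
    "I s'" "Q s'" "v \<le> \<psi> s'"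
  shows "ev (RStore a x) s (Suc t) Q \<psi> v"
  unfolding ev_def using assms
  by (intro exI[of _ "return_pmf s'"]) (auto intro!: yields_once ennreal_leI)

lemma ev_Flip:
  assumes "I s" "\<And>b. s' b = s\<lparr>mem := (mem s)(aval f s a := of_bool b)\<rparr>" "\<And>b. I (s' b)" "\<And>b. Q (s' b)"
    "\<And>b. \<psi> (s' b) \<ge> 0" "v \<le> (\<psi> (s' True) + \<psi> (s' False)) / 2"
  shows "ev (Flip a) s (Suc t) Q \<psi> v"
proof -
  have half: "ennreal a * ennreal (1/2) = ennreal (a / 2)" if "a \<ge> 0" for a
    using that ennreal_mult[of a "1/2"] by (simp only: times_divide_eq_right) simp
  have "(\<integral>\<^sup>+ x. ennreal (\<psi> x) \<partial>map_pmf s' (bernoulli_pmf (1/2))) =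
      ennreal (\<psi> (s' True)) * ennreal (1/2) + ennreal (\<psi> (s' False)) * ennreal (1/2)"
    by simp
  also have "\<dots> = ennreal ((\<psi> (s' True) + \<psi> (s' False)) / 2)"
    using assms(5)[of True] assms(5)[of False]
    by (simp only: half add_divide_distrib) (simp flip: ennreal_plus)
  finally have "ennreal v \<le> (\<integral>\<^sup>+ x. ennreal (\<psi> x) \<partial>map_pmf s' (bernoulli_pmf (1/2)))"
    using assms(6) ennreal_leI by metis
  moreover have "yields (Flip a) s (Suc t) (map_pmf s' (bernoulli_pmf (1/2)))"
    using assms(1-3) by (intro yields_once) (auto simp: map_pmf_comp)
  ultimately show ?thesis
    unfolding ev_def using assms(4) by (intro exI[of _ "map_pmf s' (bernoulli_pmf (1/2))"]) auto
qed

text \<open>The tower property: \<open>\<theta>\<close> is the expectation that \<open>d\<close>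
  guarantees from the intermediate state, and \<open>c\<close> guarantees the expectation of
  \<open>\<theta>\<close>.\<close>

lemma ev_Seq:
  assumes "ev c s t R \<theta> v" "\<And>s'. I s' \<Longrightarrow> R s' \<Longrightarrow> ev d s' u Q \<psi> (\<theta> s')"
  shows "ev (Seq c d) s (t + u + 1) Q \<psi> v"
proof -
  obtain \<mu> where \<mu>: "yields c s t \<mu>" "\<forall>s'\<in>set_pmf \<mu>. R s'"
    "ennreal v \<le> (\<integral>\<^sup>+ s'. ennreal (\<theta> s') \<partial>measure_pmf \<mu>)"
    using assms(1) unfolding ev_def by blast
  have "\<exists>\<nu>. \<forall>s'\<in>set_pmf \<mu>. yields d s' u (\<nu> s') \<and> (\<forall>s''\<in>set_pmf (\<nu> s'). Q s'') \<and>
      ennreal (\<theta> s') \<le> (\<integral>\<^sup>+ s''. ennreal (\<psi> s'') \<partial>measure_pmf (\<nu> s'))"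
    using assms(2) \<mu>(2) yields_inv_end[OF \<mu>(1)] unfolding ev_def by (intro bchoice) blast
  then obtain \<nu> where \<nu>: "\<forall>s'\<in>set_pmf \<mu>. yields d s' u (\<nu> s') \<and> (\<forall>s''\<in>set_pmf (\<nu> s'). Q s'') \<and>
      ennreal (\<theta> s') \<le> (\<integral>\<^sup>+ s''. ennreal (\<psi> s'') \<partial>measure_pmf (\<nu> s'))"
    by blast
  have "(\<integral>\<^sup>+ s'. ennreal (\<theta> s') \<partial>measure_pmf \<mu>) \<le>
      (\<integral>\<^sup>+ s'. (\<integral>\<^sup>+ s''. ennreal (\<psi> s'') \<partial>measure_pmf (\<nu> s')) \<partial>measure_pmf \<mu>)"
    using \<nu> by (intro nn_integral_mono_AE) (auto simp: AE_measure_pmf_iff)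
  then have "ennreal v \<le> (\<integral>\<^sup>+ s'. ennreal (\<psi> s') \<partial>measure_pmf (bind_pmf \<mu> \<nu>))"
    using \<mu>(3) by simp
  then show ?thesis
    unfolding ev_def using \<mu> \<nu> yields_Seq[OF \<mu>(1), of d u \<nu>] by (intro exI[of _ "bind_pmf \<mu> \<nu>"]) auto
qed

lemma ev_step:
  assumes "step \<epsilon> f (c, s) = return_pmf (c', s)" "ev c' s t Q \<psi> v"
  shows "ev c s (Suc t) Q \<psi> v"
  using assms yields_step unfolding ev_def by blast

lemma ev_Cond:
  assumes "bval \<epsilon> f s b \<Longrightarrow> ev c s t Q \<psi> v" "\<not> bval \<epsilon> f s b \<Longrightarrow> ev d s t Q \<psi> v"
  shows "ev (Cond b c d) s (Suc t) Q \<psi> v"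
  by (rule ev_step[of _ _ "if bval \<epsilon> f s b then c else d"]) (use assms in auto)

text \<open>A bound on \<open>\<psi>\<close> that holds in every final state bounds its expectation.
  Pieces without coin flips can therefore be verified through their postcondition alone.\<close>

lemma ev_lift:
  assumes "ev c s t (\<lambda>s'. Q s' \<and> v \<le> \<psi> s') (\<lambda>_. 0) 0"
  shows "ev c s t Q \<psi> v"
proof -
  obtain \<mu> where \<mu>: "yields c s t \<mu>" "\<forall>s'\<in>set_pmf \<mu>. Q s' \<and> v \<le> \<psi> s'"
    using assms(1) unfolding ev_def by blast
  have "ennreal v = (\<integral>\<^sup>+ s'. ennreal v \<partial>measure_pmf \<mu>)"
    by simp
  also have "\<dots> \<le> (\<integral>\<^sup>+ s'. ennreal (\<psi> s') \<partial>measure_pmf \<mu>)"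
    using \<mu>(2) by (intro nn_integral_mono_AE) (auto simp: AE_measure_pmf_iff intro!: ennreal_leI)
  finally show ?thesis using \<mu> unfolding ev_def by blast
qed

lemma ev_Store_Seq:
  assumes "I s" "s' = s\<lparr>mem := (mem s)(aval f s a := aval f s b)\<rparr>" "I s'" "ev d s' t Q \<psi> v"
  shows "ev (Seq (Store a b) d) s (t + 2) Q \<psi> v"
proof -
  have "ev (Seq (Store a b) d) s (Suc 0 + t + 1) Q \<psi> v"
    by (rule ev_Seq[OF ev_Store[where Q = "\<lambda>x. x = s'" and \<psi> = "\<lambda>_. v"]]) (use assms in auto)
  then show ?thesis by (simp add: numeral_2_eq_2)
qed

lemma ev_RStore_Seq:
  assumes "I s" "s' = s\<lparr>rmem := (rmem s)(aval f s a := (rval \<epsilon> f s x, rlen f s x))\<rparr>" "I s'"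
    "ev d s' t Q \<psi> v"
  shows "ev (Seq (RStore a x) d) s (t + 2) Q \<psi> v"
proof -
  have "ev (Seq (RStore a x) d) s (Suc 0 + t + 1) Q \<psi> v"
    by (rule ev_Seq[OF ev_RStore[where Q = "\<lambda>x. x = s'" and \<psi> = "\<lambda>_. v"]]) (use assms in auto)
  then show ?thesis by (simp add: numeral_2_eq_2)
qed

text \<open>The index \<open>i\<close> counts completed rounds, and \<open>\<phi>\<close> may vary
  with it, like the success probability that remains. A round costs \<open>t + 3\<close>: unfolding
  the loop, the test, the body, and leaving the sequence. The last 2 steps are the failing
  test.\<close>

lemma ev_While:
  assumes body: "\<And>i s. i < n \<Longrightarrow> I s \<Longrightarrow> P i s \<Longrightarrow>
      bval \<epsilon> f s b \<and> ev c s t (P (Suc i)) (\<phi> (Suc i)) (\<phi> i s)"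
    and exit: "\<And>s. P n s \<Longrightarrow> \<not> bval \<epsilon> f s b"
    and init: "I s" "P 0 s" "v \<le> \<phi> 0 s"
  shows "ev (While b c) s (n * (t + 3) + 2) (P n) (\<phi> n) v"
proof -
  \<comment> \<open>Induction on the number \<open>k\<close> of rounds still to come.\<close>
  have "ev (While b c) s (k * (t + 3) + 2) (P n) (\<phi> n) (\<phi> (n - k) s)"
    if "k \<le> n" "I s" "P (n - k) s" for k s
    using that
  proof (induction k arbitrary: s)
    case 0
    then have "ev (Cond b (Seq c (While b c)) Skip) s 1 (P n) (\<phi> n) (\<phi> n s)"
      unfolding One_nat_def using exit[of s] by (intro ev_Cond ev_Skip) auto
    then have "ev (While b c) s (Suc 1) (P n) (\<phi> n) (\<phi> n s)"
      by (rule ev_step[rotated]) simp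
    then show ?case by (simp add: numeral_2_eq_2)
  next
    case (Suc k)
    have eq: "Suc (n - Suc k) = n - k" using Suc by simp
    note b = body[OF _ Suc.prems(2,3), unfolded eq]
    have "ev (Cond b (Seq c (While b c)) Skip) s (Suc (t + (k * (t + 3) + 2) + 1)) (P n) (\<phi> n)
        (\<phi> (n - Suc k) s)"
      by (intro ev_Cond ev_Seq[where R = "P (n - k)" and \<theta> = "\<phi> (n - k)"] Suc.IH)
        (use b Suc.prems in auto)
    then have "ev (While b c) s (Suc (Suc (t + (k * (t + 3) + 2) + 1))) (P n) (\<phi> n)
        (\<phi> (n - Suc k) s)"
      by (rule ev_step[rotated]) simp
    moreover have "Suc (Suc (t + (k * (t + 3) + 2) + 1)) = Suc k * (t + 3) + 2"
      by simp
    ultimately show ?case by (simp only:)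
  qed
  from this[of n s] init show ?thesis
    by (auto intro: ev_mono)
qed

text \<open>A function below the indicator of \<open>G\<close> has expectation at most the
  probability of \<open>G\<close>; where it is negative, \<open>ennreal\<close> replaces it by
  zero.\<close>

lemma prob_ge_of_ev:
  assumes "ev c s t Q \<psi> v" "\<And>s'. I s' \<Longrightarrow> Q s' \<Longrightarrow> \<psi> s' \<le> indicator G s'"
  shows "measure_pmf.prob (steps \<epsilon> f t (c, s)) {(c', s'). s' \<in> G} \<ge> v"
proof -
  obtain \<mu> where \<mu>: "yields c s t \<mu>" "\<forall>s'\<in>set_pmf \<mu>. Q s'"
    "ennreal v \<le> (\<integral>\<^sup>+ s'. ennreal (\<psi> s') \<partial>measure_pmf \<mu>)"
    using assms(1) unfolding ev_def by blast
  have "ennreal (\<psi> s') \<le> indicator G s'" if "s' \<in> set_pmf \<mu>" for s'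
    using assms(2)[of s'] \<mu>(2) yields_inv_end[OF \<mu>(1)] that
    by (cases "s' \<in> G") (auto simp: ennreal_neg)
  then have "(\<integral>\<^sup>+ s'. ennreal (\<psi> s') \<partial>measure_pmf \<mu>) \<le> (\<integral>\<^sup>+ s'. indicator G s' \<partial>measure_pmf \<mu>)"
    by (intro nn_integral_mono_AE) (auto simp: AE_measure_pmf_iff)
  with \<mu>(3) have "ennreal v \<le> (\<integral>\<^sup>+ s'. indicator G s' \<partial>measure_pmf \<mu>)"
    by (rule order_trans)
  also have "\<dots> = ennreal (measure_pmf.prob \<mu> G)"
    by (simp add: measure_pmf.emeasure_eq_measure)
  finally have "v \<le> measure_pmf.prob \<mu> G"
    by simp
  also have "\<dots> = measure_pmf.prob (steps \<epsilon> f t (c, s)) {(c', s'). s' \<in> G}"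
    using \<mu>(1) by (simp add: yields_def vimage_def)
  finally show ?thesis .
qed

lemma ev_halts: "ev c s t Q \<psi> v \<Longrightarrow> x \<in> set_pmf (steps \<epsilon> f t (c, s)) \<Longrightarrow> fst x = Skip"
  unfolding ev_def yields_def by auto

lemma ev_inv: "ev c s t Q \<psi> v \<Longrightarrow> x \<in> set_pmf (steps \<epsilon> f u (c, s)) \<Longrightarrow> I (snd x)"
  unfolding ev_def yields_def by blast

end

section \<open>Counting good assignments\<close>

lemma binomial_term_Suc:
  fixes a b :: nat
  assumes "i < N"
  shows "(N choose Suc i) * a ^ Suc i * b ^ (N - Suc i) * (Suc i * b) =
    (N choose i) * a ^ i * b ^ (N - i) * ((N - i) * a)"
proof -
  have "(N choose Suc i) * Suc i = (N choose i) * (N - i)"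
    by (metis Suc_times_binomial_eq binomial_absorb_comp binomial_absorption mult.commute)
  moreover have "b ^ (N - i) = b ^ (N - Suc i) * b"
    using assms by (metis Suc_diff_Suc power_Suc2)
  ultimately have "(N choose Suc i) * Suc i * (a ^ i * a) * (b ^ (N - Suc i) * b) =
      (N choose i) * (N - i) * (a ^ i * a) * b ^ (N - i)"
    by (simp only:)
  then show ?thesis
    unfolding power_Suc2 by (simp only: mult_ac)
qed

text \<open>By \<open>binomial_term_Suc\<close> with \<open>a = r + 1\<close> and
  \<open>b = N - r\<close>, the ratio of term \<open>j + 1\<close> to term \<open>j\<close> is
  \<open>(N - j) * (r + 1) / ((j + 1) * (N - r))\<close>. It decreases in \<open>j\<close> and
  equals 1 at \<open>j = r\<close>, so the terms rise up to \<open>r\<close> and do not rise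
  afterwards. Cross-multiplication keeps this in the natural numbers.\<close>

lemma binomial_term_le_mode:
  assumes "r < N" "i \<le> N"
  shows "(N choose i) * Suc r ^ i * (N - r) ^ (N - i) \<le> (N choose r) * Suc r ^ r * (N - r) ^ (N - r)"
proof -
  define T where "T j = (N choose j) * Suc r ^ j * (N - r) ^ (N - j)" for j
  have T: "T (Suc j) * (Suc j * (N - r)) = T j * ((N - j) * Suc r)" if "j < N" for j
    unfolding T_def using binomial_term_Suc[OF that] .
  have up: "T j \<le> T (Suc j)" if "j < r" for j
  proof -
    have "Suc j * (N - r) \<le> Suc r * (N - j)"
      using that by (intro mult_mono) auto
    then have "T j * (Suc j * (N - r)) \<le> T (Suc j) * (Suc j * (N - r))"
      using T[of j] that assms mult_le_mono2[of _ _ "T j"] by (simp add: mult.commute)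
    then show ?thesis using assms by simp
  qed
  have down: "T (Suc j) \<le> T j" if "r \<le> j" "j < N" for j
  proof -
    have "Suc r * (N - j) \<le> Suc j * (N - r)"
      using that by (intro mult_mono) auto
    then have "T (Suc j) * (Suc j * (N - r)) \<le> T j * (Suc j * (N - r))"
      using T[of j] that mult_le_mono2[of _ _ "T j"] by (simp add: mult.commute)
    then show ?thesis using assms by simp
  qed
  have "T i \<le> T r"
  proof (cases "i \<le> r")
    case True
    then show ?thesis
    proof (induction rule: inc_induct)
      case (step j)
      then show ?case using up[of j] by simp
    qed simp
  next
    case False
    then have "r \<le> i" by simp
    then show ?thesis
      using assms(2)
    proof (induction rule: dec_induct)
      case (step j)
      then show ?case using down[of j] by simp
    qed simp
  qed
  then show ?thesis by (simp add: T_def)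
qed

text \<open>The \<open>N + 1\<close> binomial probabilities sum to 1, so the largest is at least
  \<open>1 / (N + 1)\<close>. The argument is carried out with the probabilities multiplied by
  \<open>(N + 1) ^ N\<close>.\<close>

lemma binomial_mode_ge:
  assumes "r < N"
  defines "q \<equiv> real (Suc r) / real (Suc N)"
  shows "1 \<le> real (Suc N) * (real (N choose r) * q ^ r * (1 - q) ^ (N - r))"
proof -
  have "Suc N ^ N = (Suc r + (N - r)) ^ N"
    using assms by simp
  also have "\<dots> = (\<Sum>i\<le>N. (N choose i) * Suc r ^ i * (N - r) ^ (N - i))"
    by (rule binomial[of "Suc r" "N - r" N, simplified of_nat_id])
  also have "\<dots> \<le> (\<Sum>i\<le>N. (N choose r) * Suc r ^ r * (N - r) ^ (N - r))"
    using assms by (intro sum_mono binomial_term_le_mode) auto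
  finally have "Suc N ^ N \<le> Suc N * ((N choose r) * Suc r ^ r * (N - r) ^ (N - r))"
    by simp
  then have le: "real (Suc N) ^ N \<le> real (Suc N) * (real (N choose r) * real (Suc r) ^ r * real (N - r) ^ (N - r))"
    by (simp only: flip: of_nat_power of_nat_mult of_nat_le_iff)
  have q1: "1 - q = real (N - r) / real (Suc N)"
    using assms by (simp add: field_simps of_nat_diff)
  have "real (N choose r) * q ^ r * (1 - q) ^ (N - r) =
      (real (N choose r) * real (Suc r) ^ r * real (N - r) ^ (N - r)) / (real (Suc N) ^ r * real (Suc N) ^ (N - r))"
    unfolding q1 unfolding q_def by (simp add: power_divide)
  also have "real (Suc N) ^ r * real (Suc N) ^ (N - r) = real (Suc N) ^ N"
    using assms by (simp flip: power_add)
  finally have eq: "real (N choose r) * q ^ r * (1 - q) ^ (N - r) =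
      (real (N choose r) * real (Suc r) ^ r * real (N - r) ^ (N - r)) / real (Suc N) ^ N" .
  have "0 < real (Suc N) ^ N" by simp
  with le show ?thesis
    unfolding eq times_divide_eq_right by (simp only: le_divide_eq_1_pos)
qed

text \<open>Gibbs' inequality, from \<open>ln t \<le> t - 1\<close>.\<close>

lemma binary_entropy_le_cross_entropy:
  assumes "0 \<le> p" "p \<le> 1" "0 < q" "q < 1"
  shows "binary_entropy p \<le> - p * log 2 q - (1 - p) * log 2 (1 - q)"
proof -
  have gibbs: "x * log 2 y - x * log 2 x \<le> (y - x) / ln 2" if "0 \<le> x" "0 < y" for x y :: real
  proof (cases "x = 0")
    case False
    with that have "x * (ln y - ln x) \<le> x * (y / x - 1)"
      using ln_le_minus_one[of "y / x"] by (intro mult_left_mono) (auto simp: ln_div)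
    also have "x * (y / x - 1) = y - x"
      using False by (simp add: field_simps)
    finally have "x * ln y - x * ln x \<le> y - x"
      by (simp only: right_diff_distrib)
    then have "(x * ln y - x * ln x) / ln 2 \<le> (y - x) / ln 2"
      by (intro divide_right_mono) auto
    then show ?thesis by (simp add: log_def diff_divide_distrib)
  qed (use that in simp)
  show ?thesis
    \<comment> \<open>The two error terms \<open>(q - p) / ln 2\<close> and
      \<open>((1 - q) - (1 - p)) / ln 2\<close> cancel.\<close>
    using gibbs[of p q] gibbs[of "1 - p" "1 - q"] assms
    by (simp add: binary_entropy_def diff_divide_distrib)
qed

text \<open>With \<open>q = (r + 1) / (N + 1)\<close> the cross entropy bounds the left-hand side by
  \<open>q powr -(r + 1) * (1 - q) powr -(N - r)\<close>, and \<open>r\<close> is a mode of the binomial distribution with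
  parameters \<open>N\<close> and \<open>q\<close>.\<close>

lemma two_powr_entropy_le_binomial:
  assumes p: "0 \<le> p" "p \<le> 1" and x: "0 \<le> x" "x \<le> real N"
    and r: "real r \<le> p * x" "p * x < real r + 1"
  shows "2 powr (binary_entropy p * x) \<le> (real N + 1) ^ 2 * real (N choose r)"
proof (cases "r < N")
  case True
  define q where "q = real (Suc r) / real (Suc N)"
  have q: "0 < q" "q < 1" using True by (auto simp: q_def field_simps)
  have "binary_entropy p * x \<le> (- p * log 2 q - (1 - p) * log 2 (1 - q)) * x"
    using binary_entropy_le_cross_entropy p q x by (intro mult_right_mono) auto
  also have "\<dots> = (p * x) * (- log 2 q) + ((1 - p) * x) * (- log 2 (1 - q))"
    by (simp add: algebra_simps)
  \<comment> \<open>Rounding: \<open>p * x < r + 1\<close> bounds the first coefficient,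
    \<open>x \<le> N\<close> and \<open>r \<le> p * x\<close> bound the second, and both negated
    logarithms are nonnegative.\<close>
  also have "\<dots> \<le> real (Suc r) * (- log 2 q) + real (N - r) * (- log 2 (1 - q))"
    using q r x True by (intro add_mono mult_right_mono) (auto simp: algebra_simps of_nat_diff)
  also have "\<dots> = - log 2 (q ^ Suc r * (1 - q) ^ (N - r))"
    using q by (simp add: log_mult log_nat_power algebra_simps)
  finally have "2 powr (binary_entropy p * x) \<le> 2 powr (- log 2 (q ^ Suc r * (1 - q) ^ (N - r)))"
    by simp
  also have "\<dots> = 1 / (q ^ Suc r * (1 - q) ^ (N - r))"
    using q by (simp add: powr_minus_divide)
  also have "\<dots> = (1 / q) * (1 / (q ^ r * (1 - q) ^ (N - r)))"
    by simp
  \<comment> \<open>One factor \<open>N + 1\<close> pays for the surplus \<open>1 / q\<close> due to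
    the exponent \<open>r + 1\<close>, the other comes from the mode.\<close>
  also have "\<dots> \<le> (real N + 1) * ((real N + 1) * real (N choose r))"
  proof (intro mult_mono)
    show "1 / q \<le> real N + 1" by (simp add: q_def field_simps)
    show "1 / (q ^ r * (1 - q) ^ (N - r)) \<le> (real N + 1) * real (N choose r)"
      using binomial_mode_ge[OF True, folded q_def] q by (simp add: pos_divide_le_eq algebra_simps)
  qed (use q in auto)
  finally show ?thesis by (simp add: power2_eq_square mult.assoc)
next
  case False
  have px: "p * x \<le> x" using p x by (simp add: mult_left_le_one_le)
  \<comment> \<open>The chain \<open>N \<le> r \<le> p * x \<le> x \<le> N\<close> collapses to
    equalities, so \<open>p = 1\<close> or \<open>x = 0\<close>, and the exponent vanishes.\<close>
  with False r x have "r = N" "p * x = x"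
    by linarith+
  then have "binary_entropy p * x = 0"
    by (auto simp: binary_entropy_def)
  then show ?thesis unfolding \<open>r = N\<close> by (simp only: powr_zero_eq_one) (simp add: one_le_power)
qed

section \<open>Weighted degrees, light variables and the effect of flipping\<close>

definition wdegree :: "maxcsp \<Rightarrow> nat \<Rightarrow> real" where
  "wdegree f j = (\<Sum>i<ncons f. \<Sum>p<arity (constraints f ! i).
     if scope (constraints f ! i) ! p = j then weight (constraints f ! i) else 0)"

text \<open>The condition is multiplied out because the machine cannot divide reals. For
  \<open>r = 0\<close> it admits every variable as soon as
  \<open>\<epsilon> * total_weight f\<close> is nonnegative.\<close>

definition light :: "real \<Rightarrow> maxcsp \<Rightarrow> nat \<Rightarrow> nat set" where
  "light \<epsilon> f r = {j. j < nvars f \<and> real r * wdegree f j \<le> \<epsilon> * total_weight f}"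

text \<open>The maximum over all \<open>r < R\<close>, in the form of the running maximum that the
  program maintains. The starting value 1 is the coefficient for \<open>r = 0\<close>.\<close>

primrec flip_count :: "real \<Rightarrow> maxcsp \<Rightarrow> nat \<Rightarrow> nat" where
  "flip_count \<epsilon> f 0 = 1"
| "flip_count \<epsilon> f (Suc r) = max (flip_count \<epsilon> f r) (card (light \<epsilon> f r) choose r)"

lemma finite_light [simp]: "finite (light \<epsilon> f r)"
  by (simp add: light_def)

lemma card_light_le: "card (light \<epsilon> f r) \<le> nvars f"
  using card_mono[of "{..<nvars f}" "light \<epsilon> f r"] by (auto simp: light_def)

lemma flip_count_pos: "0 < flip_count \<epsilon> f r"
  by (induction r) auto

lemma flip_count_ge: "r < R \<Longrightarrow> card (light \<epsilon> f r) choose r \<le> flip_count \<epsilon> f R"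
  by (induction R) (auto simp: less_Suc_eq max_def)

lemma flip_count_attained: "\<exists>r. flip_count \<epsilon> f R = card (light \<epsilon> f r) choose r"
proof (induction R)
  case 0
  show ?case by (rule exI[of _ 0]) simp
qed (auto simp: max_def)

declare flip_count.simps(2) [simp del]

lemma sum_list_map_constraints: "(\<Sum>C\<leftarrow>constraints f. g C) = (\<Sum>i<ncons f. g (constraints f ! i))"
  by (simp add: sum_list_sum_nth atLeast0LessThan)

lemma wf_nth:
  assumes "wf_maxcsp f" "i < ncons f"
  shows "0 < weight (constraints f ! i)"
    and "p < arity (constraints f ! i) \<Longrightarrow> scope (constraints f ! i) ! p < nvars f"
    and "arity (constraints f ! i) \<le> nvars f"
proof -
  let ?C = "constraints f ! i"
  have C: "weight ?C > 0" "distinct (scope ?C)" "set (scope ?C) \<subseteq> {..<nvars f}"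
    using assms by (auto simp: wf_maxcsp_def)
  show "0 < weight ?C" by fact
  show "scope ?C ! p < nvars f" if "p < arity ?C"
    using subsetD[OF C(3) nth_mem[of p]] that by (simp add: arity_def)
  show "arity ?C \<le> nvars f"
    using card_mono[OF _ C(3)] distinct_card[OF C(2)] by (simp add: arity_def)
qed

text \<open>Double counting: after exchanging the sums, each scope position contributes to the one
  variable that it names.\<close>

lemma sum_wdegree:
  assumes "finite U"
  shows "(\<Sum>j\<in>U. wdegree f j) = (\<Sum>i<ncons f. \<Sum>p<arity (constraints f ! i).
     if scope (constraints f ! i) ! p \<in> U then weight (constraints f ! i) else 0)"
proof -
  have "(\<Sum>j\<in>U. wdegree f j) = (\<Sum>i<ncons f. \<Sum>p<arity (constraints f ! i). \<Sum>j\<in>U.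
     if scope (constraints f ! i) ! p = j then weight (constraints f ! i) else 0)"
    unfolding wdegree_def
    by (rule trans[OF sum.swap]) (intro sum.cong refl sum.swap)
  then show ?thesis using assms by (simp add: sum.delta')
qed

lemma wdegree_nonneg: "wf_maxcsp f \<Longrightarrow> 0 \<le> wdegree f j"
  unfolding wdegree_def using wf_nth(1) by (intro sum_nonneg) (auto intro: less_imp_le)

lemma sum_wdegree_all: "wf_maxcsp f \<Longrightarrow> (\<Sum>j<nvars f. wdegree f j) = weighted_length f"
  by (simp add: sum_wdegree weighted_length_def sum_list_map_constraints wf_nth(2))

lemma total_weight_nonneg: "wf_maxcsp f \<Longrightarrow> 0 \<le> total_weight f"
  unfolding total_weight_def sum_list_map_constraints
  using wf_nth(1) by (intro sum_nonneg) (auto intro: less_imp_le)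

lemma weighted_length_nonneg: "wf_maxcsp f \<Longrightarrow> 0 \<le> weighted_length f"
  unfolding weighted_length_def sum_list_map_constraints
  using wf_nth(1) by (intro sum_nonneg) (auto intro!: mult_nonneg_nonneg intro: less_imp_le)

lemma sat_weight_sum: "sat_weight f z = (\<Sum>i<ncons f.
    if satisfies z (constraints f ! i) then weight (constraints f ! i) else 0)"
  by (simp add: sat_weight_def sum_list_map_constraints)

lemma sat_weight_nonneg: "wf_maxcsp f \<Longrightarrow> 0 \<le> sat_weight f z"
  unfolding sat_weight_sum using wf_nth(1) by (intro sum_nonneg) (auto intro: less_imp_le)

definition flip_vars :: "nat set \<Rightarrow> bool list \<Rightarrow> bool list" where
  "flip_vars U z = map (\<lambda>j. (z ! j) \<noteq> (j \<in> U)) [0..<length z]"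

text \<open>A constraint can be lost only if its scope meets \<open>U\<close>, and then its weight
  occurs at least once in the degrees summed over \<open>U\<close>. Otherwise its predicate sees the
  same tuple as before.\<close>

lemma sat_weight_flip_vars:
  assumes wf: "wf_maxcsp f" and z: "length z = nvars f" and U: "finite U"
  shows "sat_weight f z - (\<Sum>j\<in>U. wdegree f j) \<le> sat_weight f (flip_vars U z)"
proof -
  have "(if satisfies z C then weight C else 0) \<le>
      (if satisfies (flip_vars U z) C then weight C else 0) +
      (\<Sum>p<arity C. if scope C ! p \<in> U then weight C else 0)"
    if i: "i < ncons f" "C = constraints f ! i" for i C
  proof -
    have w: "weight C > 0" using wf_nth(1)[OF wf i(1)] i(2) by simp
    show ?thesis
    proof (cases "\<exists>p<arity C. scope C ! p \<in> U")
      case True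
      then obtain p where p: "p < arity C" "scope C ! p \<in> U" by blast
      have "weight C = (\<Sum>p\<in>{p}. if scope C ! p \<in> U then weight C else 0)"
        using p by simp
      also have "\<dots> \<le> (\<Sum>p<arity C. if scope C ! p \<in> U then weight C else 0)"
        using p w by (intro sum_mono2) auto
      finally show ?thesis using w by auto
    next
      case False
      then have "map (\<lambda>j. flip_vars U z ! j) (scope C) = map (\<lambda>j. z ! j) (scope C)"
        using wf_nth(2)[OF wf i(1)] z i(2)
        by (intro nth_equalityI) (auto simp: flip_vars_def arity_def)
      then have "satisfies (flip_vars U z) C = satisfies z C"
        by (simp only: satisfies_def)
      moreover have "(\<Sum>p<arity C. if scope C ! p \<in> U then weight C else 0) \<ge> 0"
        using w by (intro sum_nonneg) auto
      ultimately show ?thesis by simp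
    qed
  qed
  then have "sat_weight f z \<le> (\<Sum>i<ncons f.
      (if satisfies (flip_vars U z) (constraints f ! i) then weight (constraints f ! i) else 0) +
      (\<Sum>p<arity (constraints f ! i). if scope (constraints f ! i) ! p \<in> U
        then weight (constraints f ! i) else 0))"
    unfolding sat_weight_sum by (intro sum_mono) auto
  also have "\<dots> = sat_weight f (flip_vars U z) + (\<Sum>j\<in>U. wdegree f j)"
    using U by (simp add: sum.distrib sat_weight_sum sum_wdegree)
  finally show ?thesis by simp
qed

section \<open>The number of good assignments and its comparison with the entropy bound\<close>

definition good :: "real \<Rightarrow> maxcsp \<Rightarrow> bool list set" where
  "good \<epsilon> f = {z \<in> assignments f. sat_weight f z \<ge> opt_weight f - \<epsilon> * total_weight f}"

lemma finite_assignments: "finite (assignments f)"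
  using finite_lists_length_eq[of "UNIV :: bool set" "nvars f"] by (simp add: assignments_def)

lemma opt_weight_attained:
  obtains z where "z \<in> assignments f" "sat_weight f z = opt_weight f"
proof -
  have "replicate (nvars f) True \<in> assignments f"
    by (simp add: assignments_def)
  then have "opt_weight f \<in> sat_weight f ` assignments f"
    unfolding opt_weight_def using finite_assignments by (intro Max_in) auto
  with that show ?thesis by auto
qed

lemma inj_on_flip_vars: "inj_on (\<lambda>U. flip_vars U z) (Pow {..<length z})"
proof (rule inj_onI)
  fix U V assume UV: "U \<in> Pow {..<length z}" "V \<in> Pow {..<length z}" "flip_vars U z = flip_vars V z"
  have "j \<in> U \<longleftrightarrow> j \<in> V" if "j < length z" for j
    using arg_cong[OF UV(3), of "\<lambda>y. y ! j"] that by (auto simp: flip_vars_def)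
  with UV(1,2) show "U = V" by auto
qed

text \<open>For the \<open>r\<close> that attains the maximum, distinct \<open>r\<close>-subsets of
  the light variables turn one optimal assignment into distinct good assignments.\<close>

lemma card_good_ge:
  assumes wf: "wf_maxcsp f" and \<epsilon>: "0 \<le> \<epsilon>"
  shows "flip_count \<epsilon> f R \<le> card (good \<epsilon> f)"
proof -
  obtain r where r: "flip_count \<epsilon> f R = card (light \<epsilon> f r) choose r"
    using flip_count_attained by blast
  obtain z where z: "z \<in> assignments f" "sat_weight f z = opt_weight f"
    by (rule opt_weight_attained)
  then have len: "length z = nvars f" by (simp add: assignments_def)
  define \<U> where "\<U> = {U. U \<subseteq> light \<epsilon> f r \<and> card U = r}"
  have "(\<lambda>U. flip_vars U z) ` \<U> \<subseteq> good \<epsilon> f"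
  proof
    fix y assume "y \<in> (\<lambda>U. flip_vars U z) ` \<U>"
    then obtain U where U: "U \<subseteq> light \<epsilon> f r" "card U = r" "y = flip_vars U z"
      by (auto simp: \<U>_def)
    have fin: "finite U" using U(1) by (rule finite_subset) simp
    have "(\<Sum>j\<in>U. wdegree f j) \<le> \<epsilon> * total_weight f"
    proof (cases "r = 0")
      case True
      then show ?thesis using U(2) fin \<epsilon> total_weight_nonneg[OF wf] by simp
    next
      case False
      \<comment> \<open>Each of the \<open>r\<close> summands \<open>real r * wdegree f j\<close> is
        at most \<open>\<epsilon> * total_weight f\<close>; cancelling \<open>r\<close> then bounds
        the loss.\<close>
      have "real r * (\<Sum>j\<in>U. wdegree f j) = (\<Sum>j\<in>U. real r * wdegree f j)"
        by (simp add: sum_distrib_left)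
      also have "\<dots> \<le> real (card U) * (\<epsilon> * total_weight f)"
        using U(1) by (intro sum_bounded_above) (auto simp: light_def)
      finally show ?thesis using False U(2) by simp
    qed
    then show "y \<in> good \<epsilon> f"
      using sat_weight_flip_vars[OF wf len fin] z(2) U(3) len
      by (simp add: good_def assignments_def flip_vars_def)
  qed
  then have "card ((\<lambda>U. flip_vars U z) ` \<U>) \<le> card (good \<epsilon> f)"
    using finite_assignments by (intro card_mono) (auto simp: good_def)
  moreover have "card ((\<lambda>U. flip_vars U z) ` \<U>) = card \<U>"
    by (intro card_image inj_on_subset[OF inj_on_flip_vars]) (auto simp: \<U>_def light_def len)
  moreover have "card \<U> = card (light \<epsilon> f r) choose r"
    by (simp add: \<U>_def n_subsets)
  ultimately show ?thesis using r by simp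
qed

text \<open>Markov's inequality for the degrees: they sum to \<open>weighted_length f\<close>, and
  each heavy one is at least \<open>\<delta> / nvars f\<close> times that sum, so at most
  \<open>nvars f / \<delta>\<close> variables are heavy.\<close>

lemma card_light_ge:
  assumes wf: "wf_maxcsp f" and l: "weighted_length f > 0" and \<delta>: "\<delta> > 1"
    and p: "p > 0" "p * ((\<delta> - 1) * weighted_length f) = \<epsilon> * total_weight f"
    and r: "real r \<le> p * ((\<delta> - 1) / \<delta> * real (nvars f))"
  shows "(\<delta> - 1) / \<delta> * real (nvars f) \<le> real (card (light \<epsilon> f r))"
proof -
  define n l where "n = real (nvars f)" and "l = weighted_length f"
  define heavy where "heavy = {..<nvars f} - light \<epsilon> f r"
  have "\<delta> * l \<le> wdegree f j * n" if "j \<in> heavy" for j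
  proof -
    have "p * ((\<delta> - 1) * l) < real r * wdegree f j"
      using that p(2) by (auto simp: heavy_def light_def l_def)
    also have "\<dots> \<le> p * ((\<delta> - 1) / \<delta> * n) * wdegree f j"
      using r wdegree_nonneg[OF wf] by (intro mult_right_mono) (auto simp: n_def)
    also have "\<dots> = p * ((\<delta> - 1) * (wdegree f j * n / \<delta>))"
      by simp
    finally have "(\<delta> - 1) * l < (\<delta> - 1) * (wdegree f j * n / \<delta>)"
      using p(1) by (simp only: mult_less_cancel_left_pos)
    then have "l < wdegree f j * n / \<delta>"
      using \<delta> by (simp only: mult_less_cancel_left_pos diff_gt_0_iff_gt)
    then show ?thesis using \<delta> by (simp add: field_simps)
  qed
  then have "real (card heavy) * (\<delta> * l) \<le> (\<Sum>j\<in>heavy. wdegree f j * n)"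
    by (intro sum_bounded_below)
  also have "\<dots> \<le> (\<Sum>j<nvars f. wdegree f j * n)"
    using wdegree_nonneg[OF wf] by (intro sum_mono2) (auto simp: heavy_def n_def)
  also have "\<dots> = l * n"
    using sum_wdegree_all[OF wf] by (simp add: l_def flip: sum_distrib_right)
  finally have "real (card heavy) * \<delta> \<le> n"
    using l by (simp add: l_def algebra_simps)
  moreover have "card heavy = nvars f - card (light \<epsilon> f r)"
    unfolding heavy_def by (subst card_Diff_subset) (auto simp: light_def)
  then have "real (card heavy) = n - real (card (light \<epsilon> f r))"
    using card_light_le[of \<epsilon> f r] by (simp add: n_def of_nat_diff)
  ultimately show ?thesis using \<delta> by (simp add: n_def field_simps)
qed

lemma two_power_le_bound_at:
  assumes wf: "wf_maxcsp f" and \<epsilon>: "0 < \<epsilon>"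
    and \<delta>: "\<delta> \<ge> 1 + \<epsilon> * total_weight f / weighted_length f"
  shows "2 ^ nvars f \<le> (real (nvars f) + 1) ^ 2 * real (flip_count \<epsilon> f (Suc (nvars f))) * bound_at \<epsilon> f \<delta>"
proof -
  define n M where "n = nvars f" and "M = flip_count \<epsilon> f (Suc n)"
  have M: "1 \<le> real M" using flip_count_pos[of \<epsilon> f "Suc n"] by (simp add: M_def)
  define p where "p = \<epsilon> * total_weight f / ((\<delta> - 1) * weighted_length f)"
  define x where "x = (\<delta> - 1) / \<delta> * real n"
  have "(1 - binary_entropy p * ((\<delta> - 1) / \<delta>)) * real n = real n - binary_entropy p * x"
    by (simp add: x_def algebra_simps)
  then have bound: "bound_at \<epsilon> f \<delta> = 2 ^ n / 2 powr (binary_entropy p * x)"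
    by (simp add: bound_at_def powr_diff powr_realpow flip: p_def n_def)
  have "2 powr (binary_entropy p * x) \<le> (real n + 1) ^ 2 * real M"
  proof (cases "weighted_length f > 0")
    case False
    \<comment> \<open>The weighted length is zero here, so \<open>p\<close> is a quotient by zero
      and the bound is the trivial \<open>2 ^ n\<close>.\<close>
    then have "p = 0" using weighted_length_nonneg[OF wf] by (simp add: p_def)
    then have "2 powr (binary_entropy p * x) = 1 * 1" by (simp add: binary_entropy_def)
    also have "\<dots> \<le> (real n + 1) ^ 2 * real M"
      using M by (intro mult_mono) (auto simp: one_le_power)
    finally show ?thesis .
  next
    case l: True
    have w: "total_weight f > 0"
    proof (rule ccontr)
      assume "\<not> total_weight f > 0"
      then have 0: "(\<Sum>i<ncons f. weight (constraints f ! i)) = 0"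
        using total_weight_nonneg[OF wf] by (simp add: total_weight_def sum_list_map_constraints)
      have "weight (constraints f ! i) = 0" if "i < ncons f" for i
        by (rule sum_nonneg_0[OF _ _ 0]) (use wf_nth(1)[OF wf] that in \<open>auto intro: less_imp_le\<close>)
      with wf_nth(1)[OF wf] have "ncons f = 0" by (cases "ncons f") fastforce+
      with l show False by (simp add: weighted_length_def)
    qed
    define a where "a = \<epsilon> * total_weight f / weighted_length f"
    \<comment> \<open>The range of \<open>\<delta>\<close> is exactly what keeps the entropy
      argument \<open>p\<close> at most 1.\<close>
    have a: "0 < a" "a \<le> \<delta> - 1" using \<epsilon> w l \<delta> by (auto simp: a_def)
    have p_eq: "p = a / (\<delta> - 1)" by (simp add: p_def a_def mult.commute)
    have p: "0 < p" "p \<le> 1" using a by (auto simp: p_eq)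
    have \<delta>1: "\<delta> > 1" using a by linarith
    have x: "0 \<le> x" "x \<le> real n"
      using \<delta>1 mult_left_le_one_le[of "real n" "(\<delta> - 1) / \<delta>"] by (auto simp: x_def)
    define r where "r = nat \<lfloor>p * x\<rfloor>"
    have r: "real r \<le> p * x" "p * x < real r + 1"
      using p x by (auto simp: r_def of_nat_nat)
    have "p * x \<le> x" using p x by (simp add: mult_left_le_one_le)
    \<comment> \<open>This puts \<open>r\<close> among the indices over which
      \<open>flip_count\<close> at \<open>Suc n\<close> takes its maximum.\<close>
    with r x have "r < Suc n" by linarith
    have "x \<le> real (card (light \<epsilon> f r))"
      unfolding x_def n_def
      by (rule card_light_ge[OF wf l \<delta>1 p(1)]) (use \<delta>1 l r in \<open>auto simp: p_def x_def n_def\<close>)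
    then have "2 powr (binary_entropy p * x) \<le>
        (real (card (light \<epsilon> f r)) + 1) ^ 2 * real (card (light \<epsilon> f r) choose r)"
      using p x r by (intro two_powr_entropy_le_binomial) auto
    also have "\<dots> \<le> (real n + 1) ^ 2 * real M"
      using flip_count_ge[OF \<open>r < Suc n\<close>] card_light_le[of \<epsilon> f r]
      by (intro mult_mono power_mono) (auto simp: M_def n_def)
    finally show ?thesis .
  qed
  then have "2 ^ n * 2 powr (binary_entropy p * x) \<le> 2 ^ n * ((real n + 1) ^ 2 * real M)"
    by (intro mult_left_mono) auto
  then have "2 ^ n \<le> (real n + 1) ^ 2 * real M * bound_at \<epsilon> f \<delta>"
    unfolding bound by (simp add: field_simps)
  then show ?thesis by (simp add: n_def M_def)
qed

lemma two_power_le_min_bound: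
  assumes wf: "wf_maxcsp f" and \<epsilon>: "0 < \<epsilon>"
  shows "2 ^ nvars f / real (flip_count \<epsilon> f (Suc (nvars f))) \<le> (real (nvars f) + 1) ^ 2 * min_bound \<epsilon> f"
proof -
  let ?c = "(real (nvars f) + 1) ^ 2 * real (flip_count \<epsilon> f (Suc (nvars f)))"
  have c: "?c > 0" by (simp add: flip_count_pos)
  \<comment> \<open>After this division the left-hand side no longer depends on
    \<open>\<delta>\<close>, so the bound passes to the infimum.\<close>
  have "2 ^ nvars f / ?c \<le> min_bound \<epsilon> f"
    unfolding min_bound_def
  proof (rule cINF_greatest)
    fix \<delta> assume "\<delta> \<in> {1 + \<epsilon> * total_weight f / weighted_length f..}"
    then have "2 ^ nvars f \<le> ?c * bound_at \<epsilon> f \<delta>"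
      using two_power_le_bound_at[OF wf \<epsilon>] by simp
    then show "2 ^ nvars f / ?c \<le> bound_at \<epsilon> f \<delta>"
      using c by (simp add: pos_divide_le_eq mult.commute)
  qed auto
  moreover have "real (flip_count \<epsilon> f (Suc (nvars f))) > 0"
    by (simp add: flip_count_pos)
  ultimately show ?thesis
    using c by (simp add: divide_le_eq mult_ac)
qed

section \<open>The program\<close>

abbreviation setm :: "state \<Rightarrow> nat \<Rightarrow> nat \<Rightarrow> state" where
  "setm s a v \<equiv> s\<lparr>mem := (mem s)(a := v)\<rparr>"

abbreviation setr :: "state \<Rightarrow> nat \<Rightarrow> real \<times> nat \<Rightarrow> state" where
  "setr s a v \<equiv> s\<lparr>rmem := (rmem s)(a := v)\<rparr>"

text \<open>Three real cells suffice: 0 holds the total weight, 1 the current sum (a degree or the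
  weight of a sample), 2 the best weight so far.\<close>

definition bounded :: "nat \<Rightarrow> nat \<Rightarrow> nat \<Rightarrow> state \<Rightarrow> bool" where
  "bounded A B L s \<longleftrightarrow> (\<forall>a. mem s a \<noteq> 0 \<longrightarrow> a < A) \<and> (\<forall>a. mem s a < 2 ^ B) \<and>
     (\<forall>a. snd (rmem s a) \<noteq> 0 \<longrightarrow> a < 3) \<and> (\<forall>a. snd (rmem s a) \<le> L)"

lemma bounded_setm: "bounded A B L s \<Longrightarrow> a < A \<Longrightarrow> v < 2 ^ B \<Longrightarrow> bounded A B L (setm s a v)"
  by (simp add: bounded_def)

lemma bounded_setr: "bounded A B L s \<Longrightarrow> a < 3 \<Longrightarrow> snd v \<le> L \<Longrightarrow> bounded A B L (setr s a v)"
  by (simp add: bounded_def)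

lemma space_le:
  assumes "bounded A B L s"
  shows "space s \<le> A * (A + B) + 3 * (3 + L)"
proof -
  have fl: "floorlog 2 a \<le> a" for a
    by (simp add: floorlog_le_iff)
  have "(\<Sum>a | mem s a \<noteq> 0. floorlog 2 a + floorlog 2 (mem s a)) \<le> (\<Sum>a | mem s a \<noteq> 0. A + B)"
  proof (intro sum_mono add_mono)
    fix a assume "a \<in> {a. mem s a \<noteq> 0}"
    then have "a < A" using assms by (auto simp: bounded_def)
    then show "floorlog 2 a \<le> A" using fl[of a] by linarith
    show "floorlog 2 (mem s a) \<le> B"
      using assms by (simp add: bounded_def floorlog_le_iff)
  qed
  also have "\<dots> \<le> A * (A + B)"
    using assms card_mono[of "{..<A}" "{a. mem s a \<noteq> 0}"] by (auto simp: bounded_def)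
  finally have 1: "(\<Sum>a | mem s a \<noteq> 0. floorlog 2 a + floorlog 2 (mem s a)) \<le> A * (A + B)" .
  have "(\<Sum>a | snd (rmem s a) \<noteq> 0. floorlog 2 a + snd (rmem s a)) \<le> (\<Sum>a | snd (rmem s a) \<noteq> 0. 3 + L)"
  proof (intro sum_mono add_mono)
    fix a assume "a \<in> {a. snd (rmem s a) \<noteq> 0}"
    then have "a < 3" using assms by (auto simp: bounded_def)
    then show "floorlog 2 a \<le> 3" using fl[of a] by linarith
    show "snd (rmem s a) \<le> L"
      using assms by (simp add: bounded_def)
  qed
  also have "\<dots> = card {a. snd (rmem s a) \<noteq> 0} * (3 + L)" by simp
  also have "\<dots> \<le> 3 * (3 + L)"
    using assms card_mono[of "{..<3}" "{a. snd (rmem s a) \<noteq> 0}"]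
    by (intro mult_le_mono1) (auto simp: bounded_def)
  finally show ?thesis using 1 by (simp add: space_def)
qed

definition agree_off :: "'a set \<Rightarrow> ('a \<Rightarrow> 'b) \<Rightarrow> ('a \<Rightarrow> 'b) \<Rightarrow> bool" where
  "agree_off M g h \<longleftrightarrow> (\<forall>a. a \<notin> M \<longrightarrow> h a = g a)"

lemma agree_off_refl [simp]: "agree_off M g g"
  by (simp add: agree_off_def)

lemma agree_off_upd [simp]: "a \<in> M \<Longrightarrow> agree_off M g (h(a := v)) = agree_off M g h"
  by (auto simp: agree_off_def)

abbreviation frame :: "nat set \<Rightarrow> nat set \<Rightarrow> state \<Rightarrow> state \<Rightarrow> bool" where
  "frame M R s s' \<equiv> agree_off M (mem s) (mem s') \<and> agree_off R (rmem s) (rmem s')"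

lemma frame_trans: "frame M R s s' \<Longrightarrow> frame M' R' s' s'' \<Longrightarrow> M' \<subseteq> M \<Longrightarrow> R' \<subseteq> R \<Longrightarrow> frame M R s s''"
  unfolding agree_off_def by (metis subsetD)

text \<open>Cells \<open>0, \<dots>, nvars f - 1\<close> hold the best assignment found so far, the scalar variables follow
  at offset \<open>nvars f\<close>, and the current sample starts at offset \<open>nvars f + 10\<close>.\<close>

abbreviation addr :: "nat \<Rightarrow> aexp" where
  "addr c \<equiv> Add NVars (Const c)"

abbreviation var :: "nat \<Rightarrow> aexp" where
  "var c \<equiv> Load (addr c)"

abbreviation real_var :: "nat \<Rightarrow> rexp" where
  "real_var c \<equiv> RLoad (Const c)"

abbreviation inc :: "nat \<Rightarrow> com" where
  "inc c \<equiv> Store (addr c) (Add (var c) (Const 1))"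

section \<open>The program text and its register allocation\<close>

definition for_loop :: "nat \<Rightarrow> aexp \<Rightarrow> com \<Rightarrow> com" where
  "for_loop c bnd body =
     Seq (Store (addr c) (Const 0)) (While (BNot (Leq bnd (var c))) (Seq body (inc c)))"

text \<open>Scalars 0 and 1 are inner loop indices, 2 is the variable \<open>j\<close>, 3 is
  \<open>r\<close>, 4 counts light variables, 5 is the binomial coefficient, 6 the running maximum,
  7 first \<open>2 ^ n\<close> and then the number of samples, 8 the sample counter. The two
  \<open>Leq\<close> tests express equality.\<close>

definition degree_prog :: com where
  "degree_prog = Seq (RStore (Const 1) (RNat (Const 0)))
     (for_loop 0 NCons (for_loop 1 (Arity (var 0))
       (Cond (BAnd (Leq (ScopeVar (var 0) (var 1)) (var 2)) (Leq (var 2) (ScopeVar (var 0) (var 1))))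
         (RStore (Const 1) (RAdd (real_var 1) (RWeight (var 0)))) Skip)))"

definition light_prog :: com where
  "light_prog = Seq (Store (addr 4) (Const 0))
     (for_loop 2 NVars (Seq degree_prog
       (Cond (RLeq (RMul (RNat (var 3)) (real_var 1)) (RMul REps (real_var 0))) (inc 4) Skip)))"

definition binomial_prog :: com where
  "binomial_prog = Seq (Store (addr 5) (Const 1))
     (for_loop 0 (var 3)
       (Store (addr 5) (Div (Mul (var 5) (Sub (var 4) (var 0))) (Add (var 0) (Const 1)))))"

text \<open>The loop bound \<open>addr 1\<close> is used as a number: it evaluates to
  \<open>nvars f + 1\<close>, so \<open>r\<close> runs from 0 to \<open>nvars f\<close>.\<close>

definition flip_count_prog :: com where
  "flip_count_prog = Seq (Store (addr 6) (Const 1))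
     (for_loop 3 (addr 1) (Seq light_prog (Seq binomial_prog
       (Cond (Leq (var 5) (var 6)) Skip (Store (addr 6) (var 5))))))"

definition total_weight_prog :: com where
  "total_weight_prog = Seq (RStore (Const 0) (RNat (Const 0)))
     (for_loop 0 NCons (RStore (Const 0) (RAdd (real_var 0) (RWeight (var 0)))))"

definition power_prog :: com where
  "power_prog = Seq (Store (addr 7) (Const 1))
     (for_loop 0 NVars (Store (addr 7) (Mul (var 7) (Const 2))))"

definition prep_prog :: "nat \<Rightarrow> com" where
  "prep_prog k = Seq total_weight_prog (Seq flip_count_prog (Seq power_prog
     (Store (addr 7) (Mul (Mul (Const k) NVars) (Add (Div (var 7) (var 6)) (Const 1))))))"

definition flip_prog :: com where
  "flip_prog = for_loop 0 NVars (Flip (Add (addr 10) (var 0)))"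

definition eval_prog :: com where
  "eval_prog = Seq (RStore (Const 1) (RNat (Const 0)))
     (for_loop 0 NCons (Cond (SatTest (var 0) (addr 10))
       (RStore (Const 1) (RAdd (real_var 1) (RWeight (var 0)))) Skip))"

definition update_prog :: com where
  "update_prog = Cond (RLeq (real_var 2) (real_var 1))
     (Seq (RStore (Const 2) (real_var 1))
       (for_loop 0 NVars (Store (var 0) (Load (Add (addr 10) (var 0))))))
     Skip"

definition sampling_prog :: "nat \<Rightarrow> com" where
  "sampling_prog k = Seq (prep_prog k) (for_loop 8 (var 7) (Seq flip_prog (Seq eval_prog update_prog)))"

text \<open>A loop raises the degree of a monomial time bound by one; since
  \<open>N \<ge> 1\<close>, all overheads are absorbed into the coefficient.\<close>

lemma loop_time_le:
  fixes N :: nat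
  assumes "x \<le> N" "t \<le> c * N ^ e" "1 \<le> N" "d = Suc e" "c + a + b + b' \<le> c'"
  shows "x * (t + a) + b + b' \<le> c' * N ^ d"
proof -
  have one: "1 \<le> N ^ j" for j using assms(3) by (simp add: one_le_power)
  have "x * (t + a) \<le> N * (c * N ^ e + a * N ^ e)"
    using assms one[of e] by (intro mult_mono add_mono) auto
  also have "\<dots> = (c + a) * N ^ d" by (simp add: algebra_simps assms(4))
  finally have "x * (t + a) \<le> (c + a) * N ^ d" .
  moreover have "b \<le> b * N ^ d" "b' \<le> b' * N ^ d" using one[of d] by simp_all
  ultimately have "x * (t + a) + b + b' \<le> (c + a) * N ^ d + b * N ^ d + b' * N ^ d"
    by (intro add_mono)
  also have "\<dots> = (c + a + b + b') * N ^ d" by (simp only: add_mult_distrib)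
  also have "\<dots> \<le> c' * N ^ d" using assms(5) by (rule mult_le_mono1)
  finally show ?thesis .
qed

text \<open>The expectation of \<open>g\<close> when \<open>xs\<close> is completed by
  \<open>i\<close> fair coin flips, unfolded in the order in which the program flips.\<close>

primrec avg :: "(bool list \<Rightarrow> real) \<Rightarrow> nat \<Rightarrow> bool list \<Rightarrow> real" where
  "avg g 0 xs = g xs"
| "avg g (Suc i) xs = (avg g i (xs @ [True]) + avg g i (xs @ [False])) / 2"

lemma avg_nonneg: "(\<And>xs. 0 \<le> g xs) \<Longrightarrow> 0 \<le> avg g i xs"
  by (induction i arbitrary: xs) auto

lemma avg_const: "avg (\<lambda>_. c) i xs = c"
  by (induction i arbitrary: xs) auto

lemma avg_if:
  "avg (\<lambda>z. if z \<in> Z then 1 else c) i xs =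
     c + (1 - c) * real (card {ys. length ys = i \<and> xs @ ys \<in> Z}) / 2 ^ i"
proof (induction i arbitrary: xs)
  case 0
  have "{ys. length ys = 0 \<and> xs @ ys \<in> Z} = (if xs \<in> Z then {[]} else {})"
    by auto
  then show ?case by simp
next
  case (Suc i)
  let ?S = "\<lambda>b. {ys. length ys = i \<and> (xs @ [b]) @ ys \<in> Z}"
  have fin: "finite (?S b)" for b
    by (rule finite_subset[OF _ finite_lists_length_eq[of "UNIV :: bool set" i]]) auto
  \<comment> \<open>The completions are split by their first bit.\<close>
  have "{ys. length ys = Suc i \<and> xs @ ys \<in> Z} = Cons True ` ?S True \<union> Cons False ` ?S False"
    by (auto simp: length_Suc_conv image_iff) (metis (full_types))+
  then have "card {ys. length ys = Suc i \<and> xs @ ys \<in> Z} = card (?S True) + card (?S False)"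
    using fin by (simp only: card_Un_disjoint[of "Cons True ` ?S True"] finite_imageI)
      (subst card_Un_disjoint, auto simp: card_image)
  then show ?case
    unfolding avg.simps Suc by (simp add: field_simps)
qed

section \<open>Verification of the preparation phase within fixed memory bounds\<close>

locale sampling =
  fixes \<epsilon> :: real and f :: maxcsp and k :: nat
  assumes wf: "wf_maxcsp f"
begin

abbreviation n where "n \<equiv> nvars f"
abbreviation m where "m \<equiv> ncons f"

definition cells :: nat where "cells = 2 * n + 10"
text \<open>The exponent leaves room for the number of samples, at most
  \<open>2 ^ (k + 2 * n + 1)\<close>, and, as \<open>x < 2 ^ x\<close>, for all loop
  indices.\<close>

definition bits :: nat where "bits = k + 2 * n + m + 4"
text \<open>Adding a weight raises the formal length by 2, and a degree takes at most
  \<open>m * n\<close> additions, starting from a zero of length 1.\<close>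

definition real_bits :: nat where "real_bits = 2 * (m * n) + 2 * m + 2"
definition N :: nat where "N = n + m + 1"

abbreviation inv :: "state \<Rightarrow> bool" where
  "inv \<equiv> bounded cells bits real_bits"

abbreviation evp where
  "evp \<equiv> ev \<epsilon> f inv"

abbreviation det where
  "det c s t Q \<equiv> ev \<epsilon> f inv c s t Q (\<lambda>_. 0) 0"

lemma N_bounds: "n \<le> N" "m \<le> N" "Suc n \<le> N" "1 \<le> N"
  by (auto simp: N_def)

lemma inv_setm: "inv s \<Longrightarrow> a < 2 * n + 10 \<Longrightarrow> v < 2 ^ bits \<Longrightarrow> inv (setm s a v)"
  using bounded_setm by (simp add: cells_def)

lemma inv_setr: "inv s \<Longrightarrow> a < 3 \<Longrightarrow> snd v \<le> real_bits \<Longrightarrow> inv (setr s a v)"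
  by (rule bounded_setr)

lemma inv_rlen: "inv s \<Longrightarrow> snd (rmem s a) \<le> real_bits"
  by (simp add: bounded_def)

lemma less_bits: "x \<le> k + 2 * n + m + 4 \<Longrightarrow> x < 2 ^ bits"
  unfolding bits_def using less_exp order_le_less_trans by blast

lemma power_less_bits: "(x :: nat) \<le> 2 ^ n \<Longrightarrow> x < 2 ^ bits"
  unfolding bits_def by (rule order_le_less_trans) (auto intro: power_strict_increasing)

lemma evp_Store:
  assumes "inv s" "aval f s a < 2 * n + 10" "aval f s b < 2 ^ bits"
    and "Q (setm s (aval f s a) (aval f s b))" "v \<le> \<psi> (setm s (aval f s a) (aval f s b))"
  shows "evp (Store a b) s (Suc t) Q \<psi> v"
  using assms by (intro ev_Store[OF _ refl] inv_setm)

lemma evp_RStore: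
  assumes "inv s" "aval f s a < 3" "rlen f s x \<le> real_bits"
    and "Q (setr s (aval f s a) (rval \<epsilon> f s x, rlen f s x))"
    and "v \<le> \<psi> (setr s (aval f s a) (rval \<epsilon> f s x, rlen f s x))"
  shows "evp (RStore a x) s (Suc t) Q \<psi> v"
  by (rule ev_RStore[OF _ refl]) (use assms in \<open>simp_all add: inv_setr\<close>)

lemma evp_Store_Seq:
  assumes "inv s" "aval f s a < 2 * n + 10" "aval f s b < 2 ^ bits"
    and "inv (setm s (aval f s a) (aval f s b)) \<Longrightarrow>
      evp d (setm s (aval f s a) (aval f s b)) t Q \<psi> v"
  shows "evp (Seq (Store a b) d) s (t + 2) Q \<psi> v"
proof -
  have "inv (setm s (aval f s a) (aval f s b))"
    using assms by (simp add: inv_setm)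
  with assms show ?thesis by (intro ev_Store_Seq[OF _ refl])
qed

lemma evp_RStore_Seq:
  assumes "inv s" "aval f s a < 3" "rlen f s x \<le> real_bits"
    and "inv (setr s (aval f s a) (rval \<epsilon> f s x, rlen f s x)) \<Longrightarrow>
      evp d (setr s (aval f s a) (rval \<epsilon> f s x, rlen f s x)) t Q \<psi> v"
  shows "evp (Seq (RStore a x) d) s (t + 2) Q \<psi> v"
proof -
  have "inv (setr s (aval f s a) (rval \<epsilon> f s x, rlen f s x))"
    using assms by (simp add: inv_setr)
  with assms show ?thesis by (intro ev_RStore_Seq[OF _ refl])
qed

text \<open>\<open>P\<close> and \<open>\<phi>\<close> are evaluated after the counter has advanced.
  The guard is re-evaluated in each round, so \<open>bnd\<close> must keep the value
  \<open>L\<close>. A round costs \<open>t + 5\<close>: the body, the increment and four steps of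
  control.\<close>

lemma ev_for_loop:
  assumes "inv s" "c < 10" "L < 2 ^ bits"
    and bnd: "\<And>i s. P i s \<Longrightarrow> aval f s bnd = L"
    and body: "\<And>i s. i < L \<Longrightarrow> inv s \<Longrightarrow> P i s \<Longrightarrow> mem s (n + c) = i \<Longrightarrow>
      evp body s t (\<lambda>s'. mem s' (n + c) = i \<and> P (Suc i) (setm s' (n + c) (Suc i)))
        (\<lambda>s'. \<phi> (Suc i) (setm s' (n + c) (Suc i))) (\<phi> i s)"
    and init: "P 0 (setm s (n + c) 0)" "v \<le> \<phi> 0 (setm s (n + c) 0)"
  shows "evp (for_loop c bnd body) s (L * (t + 5) + 4) (\<lambda>s. P L s \<and> mem s (n + c) = L) (\<phi> L) v"
proof -
  let ?P = "\<lambda>i s. P i s \<and> mem s (n + c) = i"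
  have inv_c: "inv (setm s (n + c) i)" if "inv s" "i \<le> L" for i s
    using that assms(2,3) by (intro inv_setm) auto
  have step: "evp (Seq body (inc c)) s (t + 1 + 1) (?P (Suc i)) (\<phi> (Suc i)) (\<phi> i s)"
    if "i < L" "inv s" "?P i s" for i s
  proof (rule ev_Seq[OF body])
    fix s' assume s': "inv s'" "mem s' (n + c) = i \<and> P (Suc i) (setm s' (n + c) (Suc i))"
    show "evp (inc c) s' 1 (?P (Suc i)) (\<phi> (Suc i)) (\<phi> (Suc i) (setm s' (n + c) (Suc i)))"
      unfolding One_nat_def
      by (rule ev_Store[where s' = "setm s' (n + c) (Suc i)"]) (use s' that inv_c in auto)
  qed (use that in auto)
  have "evp (While (BNot (Leq bnd (var c))) (Seq body (inc c))) (setm s (n + c) 0)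
      (L * (t + 1 + 1 + 3) + 2) (?P L) (\<phi> L) v"
  proof (rule ev_While)
    show "bval \<epsilon> f s (BNot (Leq bnd (var c))) \<and>
        evp (Seq body (inc c)) s (t + 1 + 1) (?P (Suc i)) (\<phi> (Suc i)) (\<phi> i s)"
      if "i < L" "inv s" "?P i s" for i s
      using step[OF that] bnd[of i s] that by simp
    show "\<not> bval \<epsilon> f s (BNot (Leq bnd (var c)))" if "?P L s" for s
      using bnd[of L s] that by simp
  qed (use init inv_c[OF assms(1)] in auto)
  then have "evp (for_loop c bnd body) s (L * (t + 1 + 1 + 3) + 2 + 2) (?P L) (\<phi> L) v"
    unfolding for_loop_def
    by (intro ev_Store_Seq[where s' = "setm s (n + c) 0"] inv_c assms(1)) auto
  then show ?thesis by (simp add: eval_nat_numeral)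
qed

lemmas det_for_loop = ev_for_loop[where \<phi> = "\<lambda>_ _. 0" and v = 0, OF _ _ _ _ _ _ order_refl]

lemma ev_degree_prog:
  assumes s: "inv s"
  shows "det degree_prog s (22 * N ^ 2)
    (\<lambda>s'. fst (rmem s' 1) = wdegree f (mem s (n + 2)) \<and> frame {n, n + 1} {1} s s')"
proof -
  define j where "j = mem s (n + 2)"
  define h where "h i p = (if scope (constraints f ! i) ! p = j then weight (constraints f ! i) else 0)" for i p
  \<comment> \<open>Each constraint is budgeted \<open>n\<close> additions whatever its arity, so
    the length bound depends on \<open>i\<close> only.\<close>
  define P where "P i s' \<longleftrightarrow> frame {n, n + 1} {1} s s' \<and>
    fst (rmem s' 1) = (\<Sum>i'<i. \<Sum>p<arity (constraints f ! i'). h i' p) \<and>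
    snd (rmem s' 1) \<le> 2 * (i * n) + 1" for i s'
  define P2 where "P2 i p s' \<longleftrightarrow> frame {n, n + 1} {1} s s' \<and> mem s' n = i \<and>
    fst (rmem s' 1) = (\<Sum>i'<i. \<Sum>p<arity (constraints f ! i'). h i' p) + (\<Sum>p'<p. h i p') \<and>
    snd (rmem s' 1) \<le> 2 * (i * n + p) + 1" for i p s'
  let ?body = "Cond (BAnd (Leq (ScopeVar (var 0) (var 1)) (var 2)) (Leq (var 2) (ScopeVar (var 0) (var 1))))
         (RStore (Const 1) (RAdd (real_var 1) (RWeight (var 0)))) Skip"
  have inner: "det (for_loop 1 (Arity (var 0)) ?body) s' (11 * N ^ 1)
      (\<lambda>s'. mem s' (n + 0) = i \<and> P (Suc i) (setm s' (n + 0) (Suc i)))"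
    if i: "i < m" and s': "inv s'" "P i s'" "mem s' (n + 0) = i" for i s'
  proof -
    have ar: "arity (constraints f ! i) \<le> n" using wf_nth(3)[OF wf i] .
    have le: "i * n + n \<le> m * n" using i by (metis Suc_leI add.commute mult_Suc mult_le_mono1)
    have "det (for_loop 1 (Arity (var 0)) ?body) s' (arity (constraints f ! i) * (Suc (Suc 0) + 5) + 4)
        (\<lambda>s'. P2 i (arity (constraints f ! i)) s' \<and> mem s' (n + 1) = arity (constraints f ! i))"
    proof (rule det_for_loop)
      show "inv s'" by fact
      show "arity (constraints f ! i) < 2 ^ bits" using ar by (intro less_bits) simp
      show "P2 i 0 (setm s' (n + 1) 0)"
        using s' by (simp add: P_def P2_def)
      show "aval f s'' (Arity (var 0)) = arity (constraints f ! i)" if "P2 i p s''" for p s''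
        using that i by (simp add: P2_def)
    next
      fix p s''
      assume p: "p < arity (constraints f ! i)" and s'': "inv s''" "P2 i p s''" "mem s'' (n + 1) = p"
      have j: "mem s'' (n + 2) = j"
        using s''(2) by (simp add: P2_def j_def agree_off_def)
      have len: "snd (rmem s'' 1) + 2 \<le> real_bits"
        using s''(2) p ar le by (simp add: P2_def real_bits_def)
      show "det ?body s'' (Suc (Suc 0)) (\<lambda>s'. mem s' (n + 1) = p \<and> P2 i (Suc p) (setm s' (n + 1) (Suc p)))"
      proof (rule ev_Cond)
        assume "bval \<epsilon> f s'' (BAnd (Leq (ScopeVar (var 0) (var 1)) (var 2)) (Leq (var 2) (ScopeVar (var 0) (var 1))))"
        then have "scope (constraints f ! i) ! p = j"
          using i p j s'' by (simp add: P2_def)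
        then show "det (RStore (Const 1) (RAdd (real_var 1) (RWeight (var 0)))) s'' (Suc 0)
            (\<lambda>s'. mem s' (n + 1) = p \<and> P2 i (Suc p) (setm s' (n + 1) (Suc p)))"
          by (intro evp_RStore s'')
            (use s'' len i in \<open>auto simp: P2_def h_def\<close>)
      next
        assume "\<not> bval \<epsilon> f s'' (BAnd (Leq (ScopeVar (var 0) (var 1)) (var 2)) (Leq (var 2) (ScopeVar (var 0) (var 1))))"
        then have "scope (constraints f ! i) ! p \<noteq> j"
          using i p j s'' by (auto simp: P2_def)
        then show "det Skip s'' (Suc 0) (\<lambda>s'. mem s' (n + 1) = p \<and> P2 i (Suc p) (setm s' (n + 1) (Suc p)))"
          by (intro ev_Skip s'') (use s'' in \<open>auto simp: P2_def h_def\<close>)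
      qed
    qed simp
    then show ?thesis
    proof (rule ev_mono)
      show "arity (constraints f ! i) * (Suc (Suc 0) + 5) + 4 \<le> 11 * N ^ 1"
        using ar N_bounds by simp
      fix s'' assume s'': "P2 i (arity (constraints f ! i)) s'' \<and> mem s'' (n + 1) = arity (constraints f ! i)"
      then show "mem s'' (n + 0) = i \<and> P (Suc i) (setm s'' (n + 0) (Suc i))"
        using ar by (auto simp: P_def P2_def)
    qed auto
  qed
  have "det degree_prog s ((m * (11 * N ^ 1 + 5) + 4) + 2) (\<lambda>s'. P m s' \<and> mem s' (n + 0) = m)"
    unfolding degree_prog_def
    by (intro evp_RStore_Seq s det_for_loop inner)
      (auto simp: real_bits_def P_def floorlog_def intro!: less_bits)
  then show ?thesis
  proof (rule ev_mono)
    show "(m * (11 * N ^ 1 + 5) + 4) + 2 \<le> 22 * N ^ 2"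
      by (rule loop_time_le[where e = 1 and c = 11]) (use N_bounds in auto)
  qed (auto simp: P_def wdegree_def h_def j_def)
qed

lemma ev_light_prog:
  assumes s: "inv s" and w: "fst (rmem s 0) = total_weight f"
  shows "det light_prog s (36 * N ^ 3)
    (\<lambda>s'. mem s' (n + 4) = card (light \<epsilon> f (mem s (n + 3))) \<and> frame {n, n + 1, n + 2, n + 4} {1} s s')"
proof -
  define r where "r = mem s (n + 3)"
  define Z where "Z j = {j'. j' < j \<and> real r * wdegree f j' \<le> \<epsilon> * total_weight f}" for j
  define P where "P j s' \<longleftrightarrow> frame {n, n + 1, n + 2, n + 4} {1} s s' \<and> mem s' (n + 4) = card (Z j)" for j s'
  have Z_le: "card (Z j) \<le> j" for j
    using card_mono[of "{..<j}" "Z j"] by (auto simp: Z_def)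
  have Z_Suc: "card (Z (Suc j)) = (if real r * wdegree f j \<le> \<epsilon> * total_weight f then Suc (card (Z j)) else card (Z j))" for j
  proof -
    have "Z (Suc j) = (if real r * wdegree f j \<le> \<epsilon> * total_weight f then insert j (Z j) else Z j)"
      by (auto simp: Z_def less_Suc_eq)
    then show ?thesis by (auto simp: Z_def)
  qed
  let ?test = "Cond (RLeq (RMul (RNat (var 3)) (real_var 1)) (RMul REps (real_var 0))) (inc 4) Skip"
  have body: "det (Seq degree_prog ?test) s' (22 * N ^ 2 + Suc (Suc 0) + 1)
      (\<lambda>s'. mem s' (n + 2) = j \<and> P (Suc j) (setm s' (n + 2) (Suc j)))"
    if j: "j < n" and s': "inv s'" "P j s'" "mem s' (n + 2) = j" for j s'
  proof (rule ev_Seq[OF ev_degree_prog[OF s'(1)]])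
    fix s'' assume s'': "inv s''" "fst (rmem s'' 1) = wdegree f (mem s' (n + 2)) \<and> frame {n, n + 1} {1} s' s''"
    have fr: "frame {n, n + 1, n + 2, n + 4} {1} s s''"
      by (rule frame_trans[where s' = s' and M' = "{n, n + 1}" and R' = "{1}"]) (use s'(2) s''(2) in \<open>auto simp: P_def\<close>)
    \<comment> \<open>\<open>degree_prog\<close> overwrites only the inner indices and real cell 1,
      so everything else that the test reads has survived.\<close>
    have v: "mem s'' (n + 2) = j" "mem s'' (n + 4) = card (Z j)" "mem s'' (n + 3) = r"
        "fst (rmem s'' 0) = total_weight f"
      using s''(2) s' fr w by (auto simp: agree_off_def P_def r_def)
    have "Suc (card (Z j)) < 2 ^ bits"
      using Z_le[of j] j by (intro less_bits) auto
    then show "det ?test s'' (Suc (Suc 0)) (\<lambda>s'. mem s' (n + 2) = j \<and> P (Suc j) (setm s' (n + 2) (Suc j)))"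
      by (intro ev_Cond evp_Store s''(1) ev_Skip)
        (use s'' v fr s'(3) in \<open>auto simp: P_def Z_Suc\<close>)
  qed
  have "det light_prog s ((n * (22 * N ^ 2 + Suc (Suc 0) + 1 + 5) + 4) + 2) (\<lambda>s'. P n s' \<and> mem s' (n + 2) = n)"
    unfolding light_prog_def
    by (intro evp_Store_Seq s det_for_loop body)
      (auto simp: P_def Z_def intro!: less_bits)
  then show ?thesis
  proof (rule ev_mono)
    have "1 \<le> N ^ 2" using N_bounds(4) by (simp add: one_le_power)
    then have "22 * N ^ 2 + Suc (Suc 0) + 1 \<le> 25 * N ^ 2"
      by linarith
    then show "(n * (22 * N ^ 2 + Suc (Suc 0) + 1 + 5) + 4) + 2 \<le> 36 * N ^ 3"
      by (rule loop_time_le[where e = 2 and c = 25, rotated]) (use N_bounds in auto)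
  qed (auto simp: P_def light_def Z_def r_def)
qed

lemma ev_binomial_prog:
  assumes s: "inv s" and b: "mem s (n + 4) \<le> n" "mem s (n + 3) \<le> n"
  shows "det binomial_prog s (12 * N)
    (\<lambda>s'. mem s' (n + 5) = (mem s (n + 4) choose mem s (n + 3)) \<and> frame {n, n + 5} {} s s')"
proof -
  define l r where "l = mem s (n + 4)" and "r = mem s (n + 3)"
  define P where "P i s' \<longleftrightarrow> frame {n, n + 5} {} s s' \<and> mem s' (n + 5) = (l choose i)" for i s'
  let ?body = "Store (addr 5) (Div (Mul (var 5) (Sub (var 4) (var 0))) (Add (var 0) (Const 1)))"
  \<comment> \<open>Product and quotient are evaluated within one store, so only binomial
    coefficients have to fit into a cell.\<close>
  have choose_less: "(l choose i) < 2 ^ bits" for i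
  proof (rule power_less_bits)
    have "(l choose i) \<le> 2 ^ l" by (rule binomial_le_pow2)
    also have "\<dots> \<le> 2 ^ n" using b by (simp add: l_def)
    finally show "(l choose i) \<le> 2 ^ n" .
  qed
  \<comment> \<open>The division is exact. For \<open>i \<ge> l\<close> the truncated difference is
    zero, in agreement with the coefficient.\<close>
  have choose_Suc: "(l choose i) * (l - i) div Suc i = (l choose Suc i)" for i
  proof -
    have "(l choose i) * (l - i) = (l choose Suc i) * Suc i"
      by (metis Suc_times_binomial_eq binomial_absorb_comp binomial_absorption mult.commute)
    then show ?thesis by (simp del: mult_Suc_right)
  qed
  have body: "det ?body s' 1 (\<lambda>s'. mem s' (n + 0) = i \<and> P (Suc i) (setm s' (n + 0) (Suc i)))"
    if s': "inv s'" "P i s'" "mem s' (n + 0) = i" for i s'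
  proof -
    have v: "mem s' (n + 4) = l" "mem s' (n + 5) = (l choose i)"
      using s' by (auto simp: agree_off_def P_def l_def)
    show ?thesis
      unfolding One_nat_def
      by (intro evp_Store s')
        (use s' v choose_less choose_Suc in \<open>auto simp: P_def simp del: binomial_Suc_Suc\<close>)
  qed
  have "det binomial_prog s ((r * (1 + 5) + 4) + 2) (\<lambda>s'. P r s' \<and> mem s' (n + 0) = r)"
    unfolding binomial_prog_def
    by (intro evp_Store_Seq s det_for_loop body)
      (use b in \<open>auto simp: P_def r_def agree_off_def intro!: less_bits\<close>)
  then show ?thesis
  proof (rule ev_mono)
    show "(r * (1 + 5) + 4) + 2 \<le> 12 * N"
      using b N_bounds by (simp add: r_def)
  qed (auto simp: P_def l_def r_def)
qed

lemma flip_count_le: "flip_count \<epsilon> f r \<le> 2 ^ n"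
proof -
  obtain r' where "flip_count \<epsilon> f r = card (light \<epsilon> f r') choose r'"
    using flip_count_attained by blast
  also have "\<dots> \<le> 2 ^ card (light \<epsilon> f r')" by (rule binomial_le_pow2)
  also have "\<dots> \<le> 2 ^ n" using card_light_le[of \<epsilon> f r'] by simp
  finally show ?thesis .
qed

lemma ev_flip_count_prog:
  assumes s: "inv s" and w: "fst (rmem s 0) = total_weight f"
  shows "det flip_count_prog s (63 * N ^ 4)
    (\<lambda>s'. mem s' (n + 6) = flip_count \<epsilon> f (Suc n) \<and> frame {n..<n + 7} {1} s s')"
proof -
  define P where "P r s' \<longleftrightarrow> frame {n..<n + 7} {1} s s' \<and> mem s' (n + 6) = flip_count \<epsilon> f r" for r s'
  let ?upd = "Cond (Leq (var 5) (var 6)) Skip (Store (addr 6) (var 5))"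
  have one: "1 \<le> N" "1 \<le> N ^ 3" "1 \<le> N ^ 4" "N \<le> N ^ 3"
    using N_bounds(4) by (simp_all add: one_le_power self_le_power)
  have body: "det (Seq light_prog (Seq binomial_prog ?upd)) s' (52 * N ^ 3)
      (\<lambda>s'. mem s' (n + 3) = r \<and> P (Suc r) (setm s' (n + 3) (Suc r)))"
    if r: "r < Suc n" and s': "inv s'" "P r s'" "mem s' (n + 3) = r" for r s'
  proof -
    have w': "fst (rmem s' 0) = total_weight f"
      using s'(2) w by (simp add: P_def agree_off_def)
    have "det (Seq light_prog (Seq binomial_prog ?upd)) s' (36 * N ^ 3 + (12 * N + Suc (Suc 0) + 1) + 1)
      (\<lambda>s'. mem s' (n + 3) = r \<and> P (Suc r) (setm s' (n + 3) (Suc r)))"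
    proof (rule ev_Seq[OF ev_light_prog[OF s'(1) w']])
      fix s1 assume s1: "inv s1" "mem s1 (n + 4) = card (light \<epsilon> f (mem s' (n + 3))) \<and>
        frame {n, n + 1, n + 2, n + 4} {1} s' s1"
      have v1: "mem s1 (n + 3) = r" "mem s1 (n + 4) = card (light \<epsilon> f r)" "mem s1 (n + 6) = flip_count \<epsilon> f r"
        using s1(2) s' by (auto simp: agree_off_def P_def)
      have fr1: "frame {n..<n + 7} {1} s s1"
        by (rule frame_trans[where s' = s' and M' = "{n, n + 1, n + 2, n + 4}" and R' = "{1}"])
          (use s'(2) s1(2) in \<open>auto simp: P_def\<close>)
      show "det (Seq binomial_prog ?upd) s1 (12 * N + Suc (Suc 0) + 1)
        (\<lambda>s'. mem s' (n + 3) = r \<and> P (Suc r) (setm s' (n + 3) (Suc r)))"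
      proof (rule ev_Seq[OF ev_binomial_prog])
        fix s2 assume s2: "inv s2" "mem s2 (n + 5) = (mem s1 (n + 4) choose mem s1 (n + 3)) \<and> frame {n, n + 5} {} s1 s2"
        have v2: "mem s2 (n + 3) = r" "mem s2 (n + 5) = (card (light \<epsilon> f r) choose r)" "mem s2 (n + 6) = flip_count \<epsilon> f r"
          using s2(2) v1 by (auto simp: agree_off_def)
        have fr2: "frame {n..<n + 7} {1} s s2"
          by (rule frame_trans[where s' = s1 and M' = "{n, n + 5}" and R' = "{}"]) (use fr1 s2(2) in auto)
        have "(card (light \<epsilon> f r) choose r) < 2 ^ bits"
          using flip_count_le[of "Suc r"] by (intro power_less_bits) (simp add: flip_count.simps(2))
        then show "det ?upd s2 (Suc (Suc 0)) (\<lambda>s'. mem s' (n + 3) = r \<and> P (Suc r) (setm s' (n + 3) (Suc r)))"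
          by (intro ev_Cond evp_Store ev_Skip s2(1))
            (use v2 fr2 in \<open>auto simp: P_def flip_count.simps(2)\<close>)
      qed (use s1(1) v1 r card_light_le in auto)
    qed
    then show ?thesis
      by (rule ev_mono) (use one in auto)
  qed
  have "det flip_count_prog s ((Suc n * (52 * N ^ 3 + 5) + 4) + 2) (\<lambda>s'. P (Suc n) s' \<and> mem s' (n + 3) = Suc n)"
    unfolding flip_count_prog_def
    by (intro evp_Store_Seq s det_for_loop body)
      (auto simp: P_def intro!: less_bits)
  then show ?thesis
  proof (rule ev_mono)
    show "(Suc n * (52 * N ^ 3 + 5) + 4) + 2 \<le> 63 * N ^ 4"
      by (rule loop_time_le[where e = 3 and c = 52]) (use N_bounds in auto)
  qed (auto simp: P_def)
qed

lemma ev_total_weight_prog: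
  assumes s: "inv s"
  shows "det total_weight_prog s (12 * N)
    (\<lambda>s'. fst (rmem s' 0) = total_weight f \<and> frame {n} {0} s s')"
proof -
  define P where "P i s' \<longleftrightarrow> frame {n} {0} s s' \<and>
    fst (rmem s' 0) = (\<Sum>i'<i. weight (constraints f ! i')) \<and> snd (rmem s' 0) \<le> 2 * i + 1" for i s'
  let ?body = "RStore (Const 0) (RAdd (real_var 0) (RWeight (var 0)))"
  have body: "det ?body s' 1 (\<lambda>s'. mem s' (n + 0) = i \<and> P (Suc i) (setm s' (n + 0) (Suc i)))"
    if i: "i < m" and s': "inv s'" "P i s'" "mem s' (n + 0) = i" for i s'
    unfolding One_nat_def
    by (intro evp_RStore s') (use i s' in \<open>auto simp: P_def real_bits_def\<close>)
  have "det total_weight_prog s ((m * (1 + 5) + 4) + 2) (\<lambda>s'. P m s' \<and> mem s' (n + 0) = m)"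
    unfolding total_weight_prog_def
    by (intro evp_RStore_Seq s det_for_loop body)
      (auto simp: P_def real_bits_def floorlog_def intro!: less_bits)
  then show ?thesis
  proof (rule ev_mono)
    show "(m * (1 + 5) + 4) + 2 \<le> 12 * N"
      using N_bounds by simp
  qed (auto simp: P_def total_weight_def sum_list_map_constraints)
qed

lemma ev_power_prog:
  assumes s: "inv s"
  shows "det power_prog s (12 * N) (\<lambda>s'. mem s' (n + 7) = 2 ^ n \<and> frame {n, n + 7} {} s s')"
proof -
  define P where "P i s' \<longleftrightarrow> frame {n, n + 7} {} s s' \<and> mem s' (n + 7) = 2 ^ i" for i s'
  let ?body = "Store (addr 7) (Mul (var 7) (Const 2))"
  have body: "det ?body s' 1 (\<lambda>s'. mem s' (n + 0) = i \<and> P (Suc i) (setm s' (n + 0) (Suc i)))"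
    if i: "i < n" and s': "inv s'" "P i s'" "mem s' (n + 0) = i" for i s'
  proof -
    have "(2::nat) ^ Suc i < 2 ^ bits"
      using i by (intro power_less_bits power_increasing) auto
    then show ?thesis
      unfolding One_nat_def
      by (intro evp_Store s') (use s' in \<open>auto simp: P_def mult.commute\<close>)
  qed
  have "det power_prog s ((n * (1 + 5) + 4) + 2) (\<lambda>s'. P n s' \<and> mem s' (n + 0) = n)"
    unfolding power_prog_def
    by (intro evp_Store_Seq s det_for_loop body) (auto simp: P_def intro!: less_bits)
  then show ?thesis
  proof (rule ev_mono)
    show "(n * (1 + 5) + 4) + 2 \<le> 12 * N"
      using N_bounds by simp
  qed (auto simp: P_def)
qed

definition iters :: nat where
  "iters = k * n * (2 ^ n div flip_count \<epsilon> f (Suc n) + 1)"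

lemma iters_less: "iters < 2 ^ bits"
proof -
  have "2 ^ n div flip_count \<epsilon> f (Suc n) + 1 \<le> 2 ^ (n + 1)"
    using add_mono[OF div_le_dividend one_le_power[of "2::nat" n], of "2 ^ n" "flip_count \<epsilon> f (Suc n)"]
    by (simp only: power_add power_one_right mult_2_right)
  then have "iters \<le> 2 ^ k * 2 ^ n * 2 ^ (n + 1)"
    unfolding iters_def using less_exp[of k] less_exp[of n] by (intro mult_mono) auto
  also have "\<dots> = 2 ^ (k + 2 * n + 1)"
    by (simp only: mult_2 flip: power_add) (simp only: ac_simps)
  also have "\<dots> < 2 ^ bits"
    unfolding bits_def by (intro power_strict_increasing) auto
  finally show ?thesis .
qed

lemma ev_prep_prog:
  assumes s: "inv s"
  shows "det (prep_prog k) s (91 * N ^ 4)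
    (\<lambda>s'. mem s' (n + 7) = iters \<and> frame {n..<n + 8} {0, 1} s s')"
proof -
  let ?Q = "\<lambda>s'. mem s' (n + 7) = iters \<and> frame {n..<n + 8} {0, 1} s s'"
  have "det (prep_prog k) s (12 * N + (63 * N ^ 4 + (12 * N + Suc 0 + 1) + 1) + 1) ?Q"
    unfolding prep_prog_def
  proof (rule ev_Seq[OF ev_total_weight_prog[OF s]])
    fix s1 assume s1: "inv s1" "fst (rmem s1 0) = total_weight f \<and> frame {n} {0} s s1"
    have fr1: "frame {n..<n + 8} {0, 1} s s1"
      by (rule frame_trans[where s' = s and M' = "{n}" and R' = "{0}"]) (use s1 in auto)
    show "det (Seq flip_count_prog (Seq power_prog
       (Store (addr 7) (Mul (Mul (Const k) NVars) (Add (Div (var 7) (var 6)) (Const 1))))))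
       s1 (63 * N ^ 4 + (12 * N + Suc 0 + 1) + 1) ?Q"
    proof (rule ev_Seq[OF ev_flip_count_prog])
      fix s2 assume s2: "inv s2" "mem s2 (n + 6) = flip_count \<epsilon> f (Suc n) \<and> frame {n..<n + 7} {1} s1 s2"
      have fr2: "frame {n..<n + 8} {0, 1} s s2"
        by (rule frame_trans[where s' = s1 and M' = "{n..<n + 7}" and R' = "{1}"]) (use fr1 s2 in auto)
      show "det (Seq power_prog
         (Store (addr 7) (Mul (Mul (Const k) NVars) (Add (Div (var 7) (var 6)) (Const 1)))))
         s2 (12 * N + Suc 0 + 1) ?Q"
      proof (rule ev_Seq[OF ev_power_prog[OF s2(1)]])
        fix s3 assume s3: "inv s3" "mem s3 (n + 7) = 2 ^ n \<and> frame {n, n + 7} {} s2 s3"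
        have fr3: "frame {n..<n + 8} {0, 1} s s3"
          by (rule frame_trans[where s' = s2 and M' = "{n, n + 7}" and R' = "{}"]) (use fr2 s3 in auto)
        have v: "mem s3 (n + 6) = flip_count \<epsilon> f (Suc n)" "mem s3 (n + 7) = 2 ^ n"
          using s2 s3 by (auto simp: agree_off_def)
        show "det (Store (addr 7) (Mul (Mul (Const k) NVars) (Add (Div (var 7) (var 6)) (Const 1))))
          s3 (Suc 0) ?Q"
          by (intro evp_Store s3(1))
            (use v iters_less fr3 in \<open>simp_all add: iters_def\<close>)
      qed
    qed (use s1 in auto)
  qed
  then show ?thesis
  proof (rule ev_mono)
    have "1 \<le> N ^ 4" "N \<le> N ^ 4" using N_bounds(4) by (simp_all add: one_le_power self_le_power)
    then show "12 * N + (63 * N ^ 4 + (12 * N + Suc 0 + 1) + 1) + 1 \<le> 91 * N ^ 4"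
      by linarith
  qed auto
qed

section \<open>The sampling loop and its success probability\<close>

definition sample :: "state \<Rightarrow> bool list" where
  "sample s = stored_assignment f s (n + 10)"

text \<open>With \<open>g\<close> arbitrary, this expresses uniformity of the sample through
  expectations, the form that \<open>ev_Seq\<close> passes on.\<close>

lemma ev_flip_prog:
  assumes s: "inv s" and g: "\<And>z. 0 \<le> g z"
  shows "evp flip_prog s (10 * N) (\<lambda>s'. frame ({n} \<union> {n + 10..<2 * n + 10}) {} s s')
    (\<lambda>s'. g (sample s')) (avg g n [])"
proof -
  define prefix where "prefix i s' = map (\<lambda>j. mem s' (n + 10 + j) \<noteq> 0) [0..<i]" for i and s' :: state
  \<comment> \<open>The conditional expectation of \<open>g\<close> given the first \<open>i\<close>
    bits; each flip averages its two continuations.\<close>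
  define \<phi> where "\<phi> i s' = avg g (n - i) (prefix i s')" for i s'
  define P where "P i s' \<longleftrightarrow> frame ({n} \<union> {n + 10..<2 * n + 10}) {} s s'" for i :: nat and s'
  have body: "evp (Flip (Add (addr 10) (var 0))) s' 1
      (\<lambda>s'. mem s' (n + 0) = i \<and> P (Suc i) (setm s' (n + 0) (Suc i)))
      (\<lambda>s'. \<phi> (Suc i) (setm s' (n + 0) (Suc i))) (\<phi> i s')"
    if i: "i < n" and s': "inv s'" "P i s'" "mem s' (n + 0) = i" for i s'
  proof -
    let ?s = "\<lambda>b. setm s' (n + 10 + i) (of_bool b)"
    have pre: "prefix (Suc i) (setm (?s b) (n + 0) (Suc i)) = prefix i s' @ [b]" for b
      by (auto simp: prefix_def)
    have "n - i = Suc (n - Suc i)" using i by simp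
    then have avg: "\<phi> i s' = (\<phi> (Suc i) (setm (?s True) (n + 0) (Suc i)) +
        \<phi> (Suc i) (setm (?s False) (n + 0) (Suc i))) / 2"
      unfolding \<phi>_def pre by simp
    have "inv (?s b)" for b
      using i s' by (intro inv_setm less_bits) auto
    then show ?thesis
      unfolding One_nat_def
      by (intro ev_Flip[where s' = ?s]) (use s' i avg g in \<open>auto simp: P_def \<phi>_def intro!: avg_nonneg\<close>)
  qed
  have "evp flip_prog s (n * (1 + 5) + 4) (\<lambda>s'. P n s' \<and> mem s' (n + 0) = n) (\<phi> n) (avg g n [])"
    unfolding flip_prog_def
    by (rule ev_for_loop[OF s _ _ _ body]) (auto simp: P_def \<phi>_def prefix_def intro!: less_bits)
  then show ?thesis
  proof (rule ev_mono)
    show "n * (1 + 5) + 4 \<le> 10 * N"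
      using N_bounds by simp
  qed (auto simp: P_def \<phi>_def prefix_def sample_def stored_assignment_def)
qed

lemma ev_eval_prog:
  assumes s: "inv s"
  shows "det eval_prog s (13 * N)
    (\<lambda>s'. fst (rmem s' 1) = sat_weight f (sample s) \<and> frame {n} {1} s s')"
proof -
  define h where "h i = (if satisfies (sample s) (constraints f ! i) then weight (constraints f ! i) else 0)" for i
  define P where "P i s' \<longleftrightarrow> frame {n} {1} s s' \<and>
    fst (rmem s' 1) = (\<Sum>i'<i. h i') \<and> snd (rmem s' 1) \<le> 2 * i + 1" for i s'
  let ?body = "Cond (SatTest (var 0) (addr 10)) (RStore (Const 1) (RAdd (real_var 1) (RWeight (var 0)))) Skip"
  have body: "det ?body s' (Suc (Suc 0)) (\<lambda>s'. mem s' (n + 0) = i \<and> P (Suc i) (setm s' (n + 0) (Suc i)))"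
    if i: "i < m" and s': "inv s'" "P i s'" "mem s' (n + 0) = i" for i s'
  proof -
    have "stored_assignment f s' (n + 10) = sample s"
      using s'(2) by (simp add: sample_def stored_assignment_def P_def agree_off_def)
    then show ?thesis
      by (intro ev_Cond evp_RStore ev_Skip s'(1))
        (use i s' in \<open>auto simp: P_def h_def real_bits_def Let_def\<close>)
  qed
  have "det eval_prog s ((m * (Suc (Suc 0) + 5) + 4) + 2) (\<lambda>s'. P m s' \<and> mem s' (n + 0) = m)"
    unfolding eval_prog_def
    by (intro evp_RStore_Seq s det_for_loop body)
      (auto simp: P_def real_bits_def floorlog_def intro!: less_bits)
  then show ?thesis
  proof (rule ev_mono)
    show "(m * (Suc (Suc 0) + 5) + 4) + 2 \<le> 13 * N"
      using N_bounds by simp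
  qed (auto simp: P_def h_def sat_weight_sum)
qed

lemma ev_update_prog:
  assumes s: "inv s" and v: "fst (rmem s 1) = sat_weight f (sample s)"
    and out: "fst (rmem s 2) \<le> sat_weight f (output_assignment f s)"
  shows "det update_prog s (13 * N)
    (\<lambda>s'. frame {..n} {2} s s' \<and> fst (rmem s' 2) \<le> sat_weight f (output_assignment f s') \<and>
      fst (rmem s 2) \<le> fst (rmem s' 2) \<and> sat_weight f (sample s) \<le> fst (rmem s' 2))"
proof -
  let ?Q = "\<lambda>s'. frame {..n} {2} s s' \<and> fst (rmem s' 2) \<le> sat_weight f (output_assignment f s') \<and>
      fst (rmem s 2) \<le> fst (rmem s' 2) \<and> sat_weight f (sample s) \<le> fst (rmem s' 2)"
  \<comment> \<open>During copying the output mixes two assignments, so the relation between real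
    cell 2 and the output is recovered only at the end.\<close>
  define P where "P i s' \<longleftrightarrow> frame {..n} {2} s s' \<and> rmem s' 2 = rmem s 1 \<and>
    (\<forall>j<i. mem s' j = mem s (n + 10 + j))" for i s'
  let ?copy = "for_loop 0 NVars (Store (var 0) (Load (Add (addr 10) (var 0))))"
  have "det update_prog s (Suc ((n * (1 + 5) + 4) + 2)) ?Q"
    unfolding update_prog_def
  proof (rule ev_Cond)
    assume "bval \<epsilon> f s (RLeq (real_var 2) (real_var 1))"
    then have le: "fst (rmem s 2) \<le> fst (rmem s 1)" by simp
    have body: "det (Store (var 0) (Load (Add (addr 10) (var 0)))) s' 1
        (\<lambda>s'. mem s' (n + 0) = i \<and> P (Suc i) (setm s' (n + 0) (Suc i)))"
      if i: "i < n" and s': "inv s'" "P i s'" "mem s' (n + 0) = i" for i s'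
    proof -
      have "mem s' (n + 10 + i) = mem s (n + 10 + i)"
        using s'(2) by (simp add: P_def agree_off_def)
      moreover have "mem s (n + 10 + i) < 2 ^ bits"
        using s by (simp add: bounded_def)
      ultimately show ?thesis
        unfolding One_nat_def
        by (intro evp_Store s'(1)) (use s' i in \<open>auto simp: P_def less_Suc_eq\<close>)
    qed
    have "det (Seq (RStore (Const 2) (real_var 1)) ?copy) s ((n * (1 + 5) + 4) + 2)
        (\<lambda>s'. P n s' \<and> mem s' (n + 0) = n)"
      by (intro evp_RStore_Seq s det_for_loop body)
        (use inv_rlen[OF s] in \<open>auto simp: P_def intro!: less_bits\<close>)
    then show "det (Seq (RStore (Const 2) (real_var 1)) ?copy) s ((n * (1 + 5) + 4) + 2) ?Q"
    proof (rule ev_mono)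
      fix s' assume P: "P n s' \<and> mem s' (n + 0) = n"
      then have "output_assignment f s' = sample s"
        by (simp add: output_assignment_def sample_def stored_assignment_def P_def)
      with P v le show "?Q s'" by (simp add: P_def)
    qed auto
  next
    assume "\<not> bval \<epsilon> f s (RLeq (real_var 2) (real_var 1))"
    then show "det Skip s ((n * (1 + 5) + 4) + 2) ?Q"
      by (intro ev_Skip s) (use v out in auto)
  qed
  then show ?thesis
  proof (rule ev_mono)
    show "Suc ((n * (1 + 5) + 4) + 2) \<le> 13 * N"
      using N_bounds by simp
  qed auto
qed

text \<open>Measured by real cell 2, which never decreases in a round, so a reached goal stays
  reached. \<open>sampling_inv\<close> transfers it to the output.\<close>

definition goal_reached :: "state \<Rightarrow> bool" where
  "goal_reached s \<longleftrightarrow> opt_weight f - \<epsilon> * total_weight f \<le> fst (rmem s 2)"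

definition good_fraction :: real where
  "good_fraction = real (card (good \<epsilon> f)) / 2 ^ n"

lemma good_fraction_le_1: "good_fraction \<le> 1"
proof -
  have "card (good \<epsilon> f) \<le> card (assignments f)"
    using finite_assignments by (intro card_mono) (auto simp: good_def)
  also have "\<dots> = 2 ^ n"
    using card_lists_length_eq[of "UNIV :: bool set" n] by (simp add: assignments_def)
  finally have "real (card (good \<epsilon> f)) \<le> 2 ^ n"
    by (metis of_nat_le_iff of_nat_numeral of_nat_power)
  then show ?thesis by (simp add: good_fraction_def)
qed

text \<open>A lower bound for the probability of reaching the goal when \<open>i\<close> rounds
  remain.\<close>

definition success :: "nat \<Rightarrow> state \<Rightarrow> real" where
  "success i s = (if goal_reached s then 1 else 1 - (1 - good_fraction) ^ i)"

lemma output_assignment_cong: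
  "(\<And>j. j < n \<Longrightarrow> mem s' j = mem s j) \<Longrightarrow> output_assignment f s' = output_assignment f s"
  by (simp add: output_assignment_def stored_assignment_def)

text \<open>An inequality, since cell 2 starts at zero while the initial all-false output may
  already satisfy constraints.\<close>

definition sampling_inv :: "state \<Rightarrow> bool" where
  "sampling_inv s \<longleftrightarrow> mem s (n + 7) = iters \<and> fst (rmem s 2) \<le> sat_weight f (output_assignment f s)"

lemma sampling_inv_setm [simp]: "sampling_inv (setm s (n + 8) i) = sampling_inv s"
  using output_assignment_cong[of "setm s (n + 8) i" s] by (simp add: sampling_inv_def)

lemma ev_round:
  assumes s: "inv s" "sampling_inv s"
  shows "evp (Seq flip_prog (Seq eval_prog update_prog)) s (40 * N)
    (\<lambda>s'. sampling_inv s' \<and> mem s' (n + 8) = mem s (n + 8)) (success i) (success (Suc i) s)"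
proof -
  let ?R = "\<lambda>s'. sampling_inv s' \<and> mem s' (n + 8) = mem s (n + 8)"
  \<comment> \<open>The samples after which the goal holds: all of them if it holds already.
    \<open>c\<close> is the success bound left after a miss.\<close>
  define Z where "Z = (if goal_reached s then UNIV else good \<epsilon> f)"
  define c where "c = 1 - (1 - good_fraction) ^ i"
  define g where "g z = (if z \<in> Z then 1 else c)" for z
  have c: "0 \<le> c" "c \<le> 1"
    using good_fraction_le_1 by (auto simp: c_def good_fraction_def power_le_one)
  have "success (Suc i) s \<le> avg g n []"
  proof (cases "goal_reached s")
    case True
    then have "avg g n [] = 1" by (simp add: g_def[abs_def] Z_def avg_const)
    with True show ?thesis by (simp add: success_def)
  next
    case False
    have "{ys. length ys = n \<and> [] @ ys \<in> good \<epsilon> f} = good \<epsilon> f"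
      by (auto simp: good_def assignments_def)
    \<comment> \<open>With \<open>\<rho>\<close> for \<open>good_fraction\<close>,
      \<open>c + (1 - c) * \<rho> = 1 - (1 - \<rho>) ^ (i + 1)\<close>.\<close>
    with False have "avg g n [] = c + (1 - c) * good_fraction"
      unfolding g_def[abs_def] avg_if by (simp add: Z_def good_fraction_def)
    with False show ?thesis by (simp add: success_def c_def algebra_simps)
  qed
  moreover have "evp (Seq flip_prog (Seq eval_prog update_prog)) s (10 * N + (13 * N + 13 * N + 1) + 1)
      ?R (success i) (avg g n [])"
  proof (rule ev_Seq[OF ev_flip_prog[OF s(1)]])
    show "0 \<le> g z" for z using c by (simp add: g_def)
    fix s1 assume s1: "inv s1" "frame ({n} \<union> {n + 10..<2 * n + 10}) {} s s1"
    have J1: "sampling_inv s1" "mem s1 (n + 8) = mem s (n + 8)" "fst (rmem s1 2) = fst (rmem s 2)"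
      using s(2) s1(2) output_assignment_cong[of s1 s] by (auto simp: sampling_inv_def agree_off_def)
    show "evp (Seq eval_prog update_prog) s1 (13 * N + 13 * N + 1) ?R (success i) (g (sample s1))"
    proof (rule ev_lift, rule ev_Seq[OF ev_eval_prog[OF s1(1)]])
      fix s2 assume s2: "inv s2" "fst (rmem s2 1) = sat_weight f (sample s1) \<and> frame {n} {1} s1 s2"
      have v2: "sample s2 = sample s1" "output_assignment f s2 = output_assignment f s1"
          "mem s2 (n + 7) = mem s1 (n + 7)" "mem s2 (n + 8) = mem s1 (n + 8)" "rmem s2 2 = rmem s1 2"
        using s2(2) by (auto simp: agree_off_def sample_def output_assignment_def stored_assignment_def)
      have "det update_prog s2 (13 * N)
        (\<lambda>s'. frame {..n} {2} s2 s' \<and> fst (rmem s' 2) \<le> sat_weight f (output_assignment f s') \<and>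
          fst (rmem s2 2) \<le> fst (rmem s' 2) \<and> sat_weight f (sample s2) \<le> fst (rmem s' 2))"
        by (rule ev_update_prog) (use s2 v2 J1 in \<open>auto simp: sampling_inv_def\<close>)
      then show "det update_prog s2 (13 * N) (\<lambda>s'. ?R s' \<and> g (sample s1) \<le> success i s')"
      proof (rule ev_mono)
        fix s' assume s': "frame {..n} {2} s2 s' \<and> fst (rmem s' 2) \<le> sat_weight f (output_assignment f s') \<and>
          fst (rmem s2 2) \<le> fst (rmem s' 2) \<and> sat_weight f (sample s2) \<le> fst (rmem s' 2)"
        then have mem: "mem s' (n + 7) = iters" "mem s' (n + 8) = mem s (n + 8)"
          using v2 J1 by (auto simp: agree_off_def sampling_inv_def)
        have "goal_reached s'" if "sample s1 \<in> Z"
          using that s' v2 J1(3) by (auto simp: Z_def good_def goal_reached_def split: if_splits)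
        then have "g (sample s1) \<le> success i s'"
          using c by (auto simp: g_def success_def c_def)
        with mem s' show "?R s' \<and> g (sample s1) \<le> success i s'"
          by (simp add: sampling_inv_def)
      qed auto
    qed
  qed
  ultimately show ?thesis
    by (elim ev_mono) (use N_bounds in auto)
qed

section \<open>Time, space and failure probability of the whole algorithm\<close>

definition run_time :: nat where
  "run_time = 100 * N ^ 4 + 45 * N * iters"

lemma inv_init: "inv init_state"
  by (simp add: bounded_def init_state_def)

lemma ev_sampling_prog:
  "evp (sampling_prog k) init_state run_time sampling_inv (success 0)
     (1 - (1 - good_fraction) ^ iters)"
proof -
  let ?round = "Seq flip_prog (Seq eval_prog update_prog)"
  have "evp (sampling_prog k) init_state (91 * N ^ 4 + (iters * (40 * N + 5) + 4) + 1)
      (\<lambda>s. sampling_inv s \<and> mem s (n + 8) = iters) (success 0) (1 - (1 - good_fraction) ^ iters)"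
    unfolding sampling_prog_def
  proof (rule ev_Seq[where \<theta> = "\<lambda>_. 1 - (1 - good_fraction) ^ iters"])
    show "evp (prep_prog k) init_state (91 * N ^ 4)
      (\<lambda>s'. mem s' (n + 7) = iters \<and> frame {n..<n + 8} {0, 1} init_state s')
      (\<lambda>_. 1 - (1 - good_fraction) ^ iters) (1 - (1 - good_fraction) ^ iters)"
      by (rule ev_lift, rule ev_mono[OF ev_prep_prog[OF inv_init]]) auto
    fix s assume s: "inv s" "mem s (n + 7) = iters \<and> frame {n..<n + 8} {0, 1} init_state s"
    have "fst (rmem s 2) = 0"
      using s(2) by (simp add: agree_off_def init_state_def)
    then have J: "sampling_inv s"
      using s(2) sat_weight_nonneg[OF wf] by (simp add: sampling_inv_def)
    have "evp (for_loop 8 (var 7) ?round) s (iters * (40 * N + 5) + 4)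
      (\<lambda>s. sampling_inv s \<and> mem s (n + 8) = iters) (success (iters - iters))
      (1 - (1 - good_fraction) ^ iters)"
    \<comment> \<open>\<open>success\<close> counts remaining rounds, the loop rule completed
      ones.\<close>
    proof (rule ev_for_loop[where \<phi> = "\<lambda>i. success (iters - i)"])
      fix i s assume i: "i < iters" and s: "inv s" "sampling_inv s" "mem s (n + 8) = i"
      have "Suc (iters - Suc i) = iters - i" using i by simp
      with ev_round[OF s(1,2), of "iters - Suc i"]
      have "evp ?round s (40 * N) (\<lambda>s'. sampling_inv s' \<and> mem s' (n + 8) = mem s (n + 8))
        (success (iters - Suc i)) (success (iters - i) s)"
        by simp
      then show "evp ?round s (40 * N)
          (\<lambda>s'. mem s' (n + 8) = i \<and> sampling_inv (setm s' (n + 8) (Suc i)))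
          (\<lambda>s'. success (iters - Suc i) (setm s' (n + 8) (Suc i))) (success (iters - i) s)"
        by (rule ev_mono)
          (use s(3) in \<open>auto simp: success_def goal_reached_def\<close>)
    next
      have "1 - (1 - good_fraction) ^ iters \<le> 1"
        using good_fraction_le_1 by simp
      then show "1 - (1 - good_fraction) ^ iters \<le> success (iters - 0) (setm s (n + 8) 0)"
        by (simp add: success_def)
    qed (use s J iters_less in \<open>simp_all, simp add: sampling_inv_def\<close>)
    then show "evp (for_loop 8 (var 7) ?round) s (iters * (40 * N + 5) + 4)
      (\<lambda>s. sampling_inv s \<and> mem s (n + 8) = iters) (success 0) (1 - (1 - good_fraction) ^ iters)"
      by simp
  qed
  then show ?thesis
  proof (rule ev_mono)
    have "1 \<le> N ^ 4" using N_bounds(4) by (simp add: one_le_power)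
    moreover have "iters \<le> N * iters" using mult_le_mono1[OF N_bounds(4), of iters] by simp
    ultimately show "91 * N ^ 4 + (iters * (40 * N + 5) + 4) + 1 \<le> run_time"
      unfolding run_time_def add_mult_distrib2 mult.assoc mult.commute[of iters] by linarith
  qed auto
qed

text \<open>Since \<open>2 ^ n div M + 1\<close> exceeds \<open>2 ^ n / M\<close>, the expected
  number of good samples is at least \<open>k * n\<close>. Then \<open>1 - x \<le> exp (- x)\<close>
  gives \<open>exp (- k * n)\<close>, and \<open>n \<le> exp n\<close> the stated form.\<close>

lemma failure_le:
  assumes "0 < n" "0 \<le> \<epsilon>"
  shows "(1 - good_fraction) ^ iters \<le> 1 / real n ^ k"
proof -
  define M where "M = flip_count \<epsilon> f (Suc n)"
  have M: "0 < M" "M \<le> card (good \<epsilon> f)"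
    unfolding M_def using flip_count_pos card_good_ge[OF wf assms(2)] by auto
  have "2 ^ n \<le> M * (2 ^ n div M + 1)"
    using dividend_less_times_div[OF M(1), of "2 ^ n"] by simp
  then have "real (2 ^ n) \<le> real (M * (2 ^ n div M + 1))"
    by (simp only: of_nat_le_iff)
  then have "2 ^ n \<le> real M * real (2 ^ n div M + 1)"
    by (simp only: of_nat_mult of_nat_power of_nat_numeral)
  then have "1 \<le> (real M / 2 ^ n) * real (2 ^ n div M + 1)"
    by (simp add: le_divide_eq)
  also have "\<dots> \<le> good_fraction * real (2 ^ n div M + 1)"
    unfolding good_fraction_def using M by (intro mult_right_mono divide_right_mono) auto
  finally have "real k * real n * 1 \<le> real k * real n * (good_fraction * real (2 ^ n div M + 1))"
    by (intro mult_left_mono) auto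
  then have q: "real k * real n \<le> good_fraction * real iters"
    by (simp only: iters_def M_def of_nat_mult mult_ac mult_1_right mult_1_left)
  have "(1 - good_fraction) ^ iters \<le> exp (- good_fraction) ^ iters"
    using good_fraction_le_1 exp_ge_add_one_self[of "- good_fraction"] by (intro power_mono) auto
  also have "\<dots> = exp (- (good_fraction * real iters))"
    by (simp only: exp_of_nat_mult[symmetric]) (simp only: mult.commute[of "real iters"] mult_minus_left)
  also have "\<dots> \<le> exp (- (real k * real n))"
    using q by simp
  also have "\<dots> = 1 / exp (real n) ^ k"
    by (simp only: exp_minus exp_of_nat_mult inverse_eq_divide)
  also have "\<dots> \<le> 1 / real n ^ k"
    using assms(1) order_trans[OF _ exp_ge_add_one_self[of "real n"], of "real n"]
    by (intro divide_left_mono power_mono mult_pos_pos zero_less_power) auto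
  finally show ?thesis .
qed

definition space_bound :: nat where
  "space_bound = cells * (cells + bits) + 3 * (3 + real_bits)"

lemma space_bound_le: "space_bound \<le> (400 + 12 * k) * N ^ 2"
proof -
  have cells: "cells \<le> 12 * N" by (simp add: cells_def N_def)
  have "bits = k * 1 + (2 * n + m + 4)" by (simp add: bits_def)
  also have "\<dots> \<le> k * N + 4 * N"
    using N_bounds by (intro add_mono mult_le_mono2) (simp_all add: N_def)
  finally have "cells * (cells + bits) \<le> 12 * N * (12 * N + (k * N + 4 * N))"
    using cells by (intro mult_le_mono add_mono)
  also have "\<dots> = (192 + 12 * k) * (N * N)"
    by (simp add: algebra_simps)
  finally have mem: "cells * (cells + bits) \<le> (192 + 12 * k) * (N * N)" .
  have "m * n \<le> N * N" "1 \<le> N * N" "m \<le> N * N"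
    using N_bounds mult_le_mono[OF N_bounds(2,1)] mult_le_mono[OF N_bounds(2,4)] by simp_all
  then have "3 * 1 + (2 * (m * n) + 2 * m + 2 * 1) \<le> 3 * (N * N) + (2 * (N * N) + 2 * (N * N) + 2 * (N * N))"
    by (intro add_mono mult_le_mono2)
  also have "\<dots> = 9 * (N * N)"
    by simp
  finally have "3 + real_bits \<le> 9 * (N * N)"
    by (simp only: real_bits_def mult_1_right)
  then have "3 * (3 + real_bits) \<le> 3 * (9 * (N * N))"
    by (rule mult_le_mono2)
  then have "3 * (3 + real_bits) \<le> 27 * (N * N)"
    by simp
  with mem have "space_bound \<le> (192 + 12 * k) * (N * N) + 27 * (N * N)"
    unfolding space_bound_def by (rule add_mono)
  also have "\<dots> = (219 + 12 * k) * (N * N)"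
    by (simp only: flip: add_mult_distrib) simp
  also have "\<dots> \<le> (400 + 12 * k) * (N * N)"
    by (intro mult_le_mono1) simp
  finally show ?thesis by (simp only: power2_eq_square)
qed

text \<open>With \<open>x = 2 ^ n / M\<close>, the time is \<open>O(N ^ 4 * x)\<close>, where
  \<open>x \<ge> 1\<close> absorbs the preparation; comparing \<open>x\<close> with
  \<open>min_bound\<close> costs the remaining \<open>N ^ 2\<close>.\<close>

lemma run_time_le:
  assumes "0 < \<epsilon>"
  shows "real run_time \<le> (100 + 90 * real k) * real N ^ 6 * min_bound \<epsilon> f"
proof -
  define x where "x = 2 ^ n / real (flip_count \<epsilon> f (Suc n))"
  have x1: "1 \<le> x"
  proof -
    have "real (flip_count \<epsilon> f (Suc n)) \<le> real (2 ^ n)"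
      using flip_count_le by (simp only: of_nat_le_iff)
    then show ?thesis
      using flip_count_pos[of \<epsilon> f "Suc n"] by (simp add: x_def)
  qed
  have x: "x \<le> real N ^ 2 * min_bound \<epsilon> f"
  proof -
    have "0 < min_bound \<epsilon> f * (real n + 1)\<^sup>2"
      using two_power_le_min_bound[OF wf assms] x1 by (simp add: x_def mult.commute)
    then have "0 \<le> min_bound \<epsilon> f" by (simp add: zero_less_mult_iff)
    then have "(real n + 1) ^ 2 * min_bound \<epsilon> f \<le> real N ^ 2 * min_bound \<epsilon> f"
      by (intro mult_right_mono power_mono) (auto simp: N_def)
    then show ?thesis
      using two_power_le_min_bound[OF wf assms] unfolding x_def by (rule order_trans[rotated])
  qed
  have N1: "1 \<le> real N" using N_bounds by simp
  have "real (2 ^ n div flip_count \<epsilon> f (Suc n)) \<le> x"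
    unfolding x_def using of_nat_div_le_of_nat[of "2 ^ n" "flip_count \<epsilon> f (Suc n)", where 'a = real] by simp
  then have "real iters \<le> real k * real N * (x + x)"
    unfolding iters_def of_nat_mult of_nat_add of_nat_1 using x1 N_bounds
    by (intro mult_mono add_mono) auto
  then have "45 * real N * real iters \<le> 45 * real N * (real k * real N * (x + x))"
    by (intro mult_left_mono) auto
  also have "\<dots> = (90 * real k * x) * real N ^ 2"
    by (simp add: power2_eq_square)
  also have "\<dots> \<le> (90 * real k * x) * real N ^ 4"
    using N1 x1 by (intro mult_left_mono power_increasing) auto
  finally have "45 * real N * real iters \<le> (90 * real k * x) * real N ^ 4" .
  moreover have "100 * real N ^ 4 * 1 \<le> 100 * real N ^ 4 * x"
    using x1 by (intro mult_left_mono) auto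
  ultimately have "real run_time \<le> (100 + 90 * real k) * real N ^ 4 * x"
    by (simp add: run_time_def algebra_simps)
  also have "\<dots> \<le> (100 + 90 * real k) * real N ^ 4 * (real N ^ 2 * min_bound \<epsilon> f)"
    using x by (intro mult_left_mono) auto
  also have "\<dots> = (100 + 90 * real k) * real N ^ 6 * min_bound \<epsilon> f"
    by (simp add: power_add[of _ 4 2, simplified] mult.assoc)
  finally show ?thesis .
qed

lemma sampling_prog_correct:
  assumes "0 \<le> \<epsilon>"
  shows "halts_within \<epsilon> f (sampling_prog k) run_time"
    and "space_within \<epsilon> f (sampling_prog k) space_bound"
    and "measure_pmf.prob (run \<epsilon> f (sampling_prog k) run_time)
         {(c, s). sat_weight f (output_assignment f s) \<ge> opt_weight f - \<epsilon> * total_weight f}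
         \<ge> 1 - 1 / real n ^ k"
proof -
  note ev = ev_sampling_prog
  show "halts_within \<epsilon> f (sampling_prog k) run_time"
    using ev_halts[OF ev] unfolding halts_within_def run_eq_steps by (metis (mono_tags, lifting) case_prodI2 fst_conv)
  show "space_within \<epsilon> f (sampling_prog k) space_bound"
    unfolding space_within_def space_bound_def run_eq_steps
    using space_le[OF ev_inv[OF ev]] by (metis (mono_tags, lifting) case_prodI2 snd_conv)
  let ?G = "{s. sat_weight f (output_assignment f s) \<ge> opt_weight f - \<epsilon> * total_weight f}"
  have "measure_pmf.prob (run \<epsilon> f (sampling_prog k) run_time) {(c, s). s \<in> ?G} \<ge> 1 - 1 / real n ^ k"
  proof (cases "n = 0")
    \<comment> \<open>No sample is drawn for \<open>n = 0\<close>, and for \<open>k > 0\<close> the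
      required probability is 1 because \<open>1 / 0 = 0\<close>. The only assignment is
      optimal.\<close>
    case True
    then have "assignments f = {[]}" "\<And>s. output_assignment f s = []"
      by (auto simp: assignments_def output_assignment_def stored_assignment_def)
    then have "?G = UNIV"
      using total_weight_nonneg[OF wf] assms by (auto simp: opt_weight_def)
    then show ?thesis by simp
  next
    case False
    have "1 - 1 / real n ^ k \<le> 1 - (1 - good_fraction) ^ iters"
      using failure_le False assms by simp
    also have "\<dots> \<le> measure_pmf.prob (run \<epsilon> f (sampling_prog k) run_time) {(c, s). s \<in> ?G}"
      unfolding run_eq_steps
      by (rule prob_ge_of_ev[OF ev])
        (auto simp: success_def goal_reached_def sampling_inv_def indicator_def)
    finally show ?thesis .
  qed
  then show "measure_pmf.prob (run \<epsilon> f (sampling_prog k) run_time)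
         {(c, s). sat_weight f (output_assignment f s) \<ge> opt_weight f - \<epsilon> * total_weight f}
         \<ge> 1 - 1 / real n ^ k"
    by simp
qed

end

theorem theorem3:
  fixes \<epsilon> :: real
  assumes "0 < \<epsilon>" and "\<epsilon> \<le> 1"
  shows "\<forall>k :: nat. \<exists>(P :: com) (T :: maxcsp \<Rightarrow> nat) (S :: maxcsp \<Rightarrow> nat).
    (\<lambda>f. real (T f)) \<in> O_star (min_bound \<epsilon>) \<and>
    (\<lambda>f. real (S f)) \<in> O_star (\<lambda>_. 1) \<and>
    (\<forall>f. wf_maxcsp f \<longrightarrow>
       halts_within \<epsilon> f P (T f) \<and>
       space_within \<epsilon> f P (S f) \<and>
       measure_pmf.prob (run \<epsilon> f P (T f))
         {(c, s). sat_weight f (output_assignment f s) \<ge> opt_weight f - \<epsilon> * total_weight f}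
         \<ge> 1 - 1 / real (nvars f) ^ k)"
proof
  fix k :: nat
  \<comment> \<open>The program depends on \<open>k\<close> alone, while the time and space bounds
    depend on the instance.\<close>
  let ?T = "\<lambda>f. sampling.run_time \<epsilon> f k" and ?S = "\<lambda>f. sampling.space_bound f k"
  have "(\<lambda>f. real (?T f)) \<in> O_star (min_bound \<epsilon>)"
    unfolding O_star_def
  proof (intro CollectI exI allI impI)
    fix f assume "wf_maxcsp f"
    then interpret sampling \<epsilon> f k by unfold_locales
    show "real run_time \<le> (100 + 90 * real k) * real (nvars f + ncons f + 1) ^ 6 * min_bound \<epsilon> f"
      using run_time_le[OF assms(1)] by (simp only: N_def)
  qed
  moreover have "(\<lambda>f. real (?S f)) \<in> O_star (\<lambda>_. 1)"
    unfolding O_star_def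
  proof (intro CollectI exI allI impI)
    fix f assume "wf_maxcsp f"
    then interpret sampling \<epsilon> f k by unfold_locales
    have "real space_bound \<le> real ((400 + 12 * k) * N ^ 2)"
      using space_bound_le by (simp only: of_nat_le_iff)
    then show "real space_bound \<le> real (400 + 12 * k) * real (nvars f + ncons f + 1) ^ 2 * 1"
      by (simp only: of_nat_mult of_nat_power N_def mult_1_right)
  qed
  moreover have "halts_within \<epsilon> f (sampling_prog k) (?T f)"
    "space_within \<epsilon> f (sampling_prog k) (?S f)"
    "measure_pmf.prob (run \<epsilon> f (sampling_prog k) (?T f))
       {(c, s). sat_weight f (output_assignment f s) \<ge> opt_weight f - \<epsilon> * total_weight f}
       \<ge> 1 - 1 / real (nvars f) ^ k" if "wf_maxcsp f" for f
    using sampling.sampling_prog_correct[OF sampling.intro[OF that]] assms(1) less_imp_le by blast+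
  ultimately show "\<exists>(P :: com) (T :: maxcsp \<Rightarrow> nat) (S :: maxcsp \<Rightarrow> nat).
    (\<lambda>f. real (T f)) \<in> O_star (min_bound \<epsilon>) \<and>
    (\<lambda>f. real (S f)) \<in> O_star (\<lambda>_. 1) \<and>
    (\<forall>f. wf_maxcsp f \<longrightarrow>
       halts_within \<epsilon> f P (T f) \<and>
       space_within \<epsilon> f P (S f) \<and>
       measure_pmf.prob (run \<epsilon> f P (T f))
         {(c, s). sat_weight f (output_assignment f s) \<ge> opt_weight f - \<epsilon> * total_weight f}
         \<ge> 1 - 1 / real (nvars f) ^ k)"
    by (intro exI[of _ "sampling_prog k"] exI[of _ ?T] exI[of _ ?S]) blast
qed

end
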